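(* Let $(T_1,\dots,T_k)$ be a tuple of contractions on a Hilbert space $\mathcal{H}$ and $q_{ij}\in\mathbb{T}$ ($1\le i<j\le k$) such that $T_iT_j=q_{ij}T_jT_i$ and $T_iT_j^*=\overline{q_{ij}}\,T_j^*T_i$ for $1\le i<j\le k$. Then there exist a Hilbert space $\mathcal{K}\supseteq\mathcal{H}$ and unitaries $U_1,\dots,U_k$ on $\mathcal{K}$ with $U_iU_j=q_{ij}U_jU_i$ for $1\le i<j\le k$, such that \[ T_1(m_1)\cdots T_k(m_k)=P_{\mathcal{H}}U_1^{m_1}\cdots U_k^{m_k}|_{\mathcal{H}} \] for all $m_1,\dots,m_k\in\mathbb{Z}$.
   Context: For a contraction $C$ and $m\in\mathbb{Z}$: $C(m)=C^m$ if $m\ge1$, $C(0)=I$, and $C(m)=(C^* )^{|m|}$ if $m<0$. $P_{\mathcal{H}}$ denotes the orthogonal projection of $\mathcal{K}$ onto $\mathcal{H}$. *)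

theory Defs
  imports "HOL-Analysis.Analysis"
begin

class complex_vector = real_vector +
  fixes scaleC :: "complex \<Rightarrow> 'a \<Rightarrow> 'a"  (infixr \<open>*\<^sub>C\<close> 75)
  assumes scaleC_add_right: "a *\<^sub>C (x + y) = a *\<^sub>C x + a *\<^sub>C y"
    and scaleC_add_left: "(a + b) *\<^sub>C x = a *\<^sub>C x + b *\<^sub>C x"
    and scaleC_scaleC: "a *\<^sub>C (b *\<^sub>C x) = (a * b) *\<^sub>C x"
    and scaleC_one: "1 *\<^sub>C x = x"
    and scaleR_scaleC: "r *\<^sub>R x = complex_of_real r *\<^sub>C x"

class complex_inner = complex_vector + real_normed_vector +
  fixes cinner :: "'a \<Rightarrow> 'a \<Rightarrow> complex"
  assumes cinner_commute: "cinner x y = cnj (cinner y x)"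
    and cinner_add_left: "cinner (x + y) z = cinner x z + cinner y z"
    and cinner_scaleC_left: "cinner (a *\<^sub>C x) y = a * cinner x y"
    and cinner_self_real: "Im (cinner x x) = 0"
    and cinner_self_nonneg: "0 \<le> Re (cinner x x)"
    and cinner_self_eq_zero: "cinner x x = 0 \<longleftrightarrow> x = 0"
    and norm_eq_sqrt_cinner: "norm x = sqrt (Re (cinner x x))"

class chilbert_space = complex_inner + complete_space

definition clinear :: "('a::complex_vector \<Rightarrow> 'b::complex_vector) \<Rightarrow> bool" where
  "clinear f \<longleftrightarrow> (\<forall>x y. f (x + y) = f x + f y) \<and> (\<forall>c x. f (c *\<^sub>C x) = c *\<^sub>C f x)"

definition contraction :: "('a::complex_inner \<Rightarrow> 'a) \<Rightarrow> bool" where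
  "contraction T \<longleftrightarrow> clinear T \<and> (\<forall>x. norm (T x) \<le> norm x)"

text \<open>Hilbert space adjoint: \<open><T x, y> = <x, T* y>\<close> (exists uniquely for bounded \<open>T\<close>).\<close>
definition cadjoint :: "('a::complex_inner \<Rightarrow> 'a) \<Rightarrow> 'a \<Rightarrow> 'a" where
  "cadjoint T y = (THE z. \<forall>x. cinner (T x) y = cinner x z)"

definition op_pow :: "('a::complex_inner \<Rightarrow> 'a) \<Rightarrow> int \<Rightarrow> 'a \<Rightarrow> 'a" where
  "op_pow C m = (if 0 \<le> m then C ^^ nat m else cadjoint C ^^ nat (- m))"

fun ordered_prod :: "(nat \<Rightarrow> 'b \<Rightarrow> 'b) \<Rightarrow> nat \<Rightarrow> 'b \<Rightarrow> 'b" where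
  "ordered_prod F 0 = id"
| "ordered_prod F (Suc n) = ordered_prod F n \<circ> F (Suc n)"

section \<open>The ambient Hilbert space \<open>l2(nat, H)\<close> in which the dilation space lives\<close>

definition l2set :: "(nat \<Rightarrow> 'a::complex_inner) set" where
  "l2set = {f. summable (\<lambda>n. (norm (f n))\<^sup>2)}"

definition l2inner :: "(nat \<Rightarrow> 'a::complex_inner) \<Rightarrow> (nat \<Rightarrow> 'a) \<Rightarrow> complex" where
  "l2inner f g = (\<Sum>n. cinner (f n) (g n))"

definition l2norm :: "(nat \<Rightarrow> 'a::complex_inner) \<Rightarrow> real" where
  "l2norm f = sqrt (Re (l2inner f f))"

definition l2add :: "(nat \<Rightarrow> 'a::complex_inner) \<Rightarrow> (nat \<Rightarrow> 'a) \<Rightarrow> nat \<Rightarrow> 'a" where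
  "l2add f g = (\<lambda>n. f n + g n)"

definition l2diff :: "(nat \<Rightarrow> 'a::complex_inner) \<Rightarrow> (nat \<Rightarrow> 'a) \<Rightarrow> nat \<Rightarrow> 'a" where
  "l2diff f g = (\<lambda>n. f n - g n)"

definition l2scale :: "complex \<Rightarrow> (nat \<Rightarrow> 'a::complex_inner) \<Rightarrow> nat \<Rightarrow> 'a" where
  "l2scale c f = (\<lambda>n. c *\<^sub>C f n)"

text \<open>A closed linear subspace of \<open>l2(nat, H)\<close>; being closed in a complete space, it is itself
  a Hilbert space with the inner product \<open>l2inner\<close>.\<close>
definition closed_l2_subspace :: "(nat \<Rightarrow> 'a::complex_inner) set \<Rightarrow> bool" where
  "closed_l2_subspace K \<longleftrightarrow>
     K \<subseteq> l2set \<and> (\<lambda>n. 0) \<in> K \<and>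
     (\<forall>f\<in>K. \<forall>g\<in>K. l2add f g \<in> K) \<and> (\<forall>c. \<forall>f\<in>K. l2scale c f \<in> K) \<and>
     (\<forall>X. (\<forall>n. X n \<in> K) \<longrightarrow>
          (\<forall>e>0. \<exists>N. \<forall>m\<ge>N. \<forall>n\<ge>N. l2norm (l2diff (X m) (X n)) < e) \<longrightarrow>
          (\<exists>y\<in>K. (\<lambda>n. l2norm (l2diff (X n) y)) \<longlonglongrightarrow> 0))"

definition unitary_on :: "(nat \<Rightarrow> 'a::complex_inner) set \<Rightarrow> ((nat \<Rightarrow> 'a) \<Rightarrow> (nat \<Rightarrow> 'a)) \<Rightarrow> bool" where
  "unitary_on K U \<longleftrightarrow> bij_betw U K K \<and>
     (\<forall>f\<in>K. \<forall>g\<in>K. U (l2add f g) = l2add (U f) (U g)) \<and>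
     (\<forall>c. \<forall>f\<in>K. U (l2scale c f) = l2scale c (U f)) \<and>
     (\<forall>f\<in>K. \<forall>g\<in>K. l2inner (U f) (U g) = l2inner f g)"

definition upow :: "(nat \<Rightarrow> 'a::complex_inner) set \<Rightarrow> ((nat \<Rightarrow> 'a) \<Rightarrow> (nat \<Rightarrow> 'a)) \<Rightarrow> int
                    \<Rightarrow> (nat \<Rightarrow> 'a) \<Rightarrow> (nat \<Rightarrow> 'a)" where
  "upow K U m = (if 0 \<le> m then U ^^ nat m else inv_into K U ^^ nat (- m))"

definition l2proj :: "(nat \<Rightarrow> 'a::complex_inner) set \<Rightarrow> (nat \<Rightarrow> 'a) \<Rightarrow> (nat \<Rightarrow> 'a)" where
  "l2proj S y = (THE p. p \<in> S \<and> (\<forall>s\<in>S. l2inner (l2diff y p) s = 0))"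

end

theory Submission
  imports Defs
begin

text \<open>The operators are made unitary one at a time. Suppose that \<open>W\<close> is one of the contractions and
  \<open>V\<close> another one, with \<open>W V = w V W\<close>. On \<open>l2(int, H)\<close> let \<open>U\<close> be the Schaeffer unitary dilation of \<open>W\<close>
  and replace \<open>V\<close> by the diagonal operator with entries \<open>w\<^sup>n V\<close>. The double commutation relations make
  \<open>V\<close> commute with \<open>W\<^sup>* W\<close> and \<open>W W\<^sup>*\<close>, hence with the two defect operators, and then the phases
  \<open>w\<^sup>n\<close> turn \<open>W V = w V W\<close> into the same relation for \<open>U\<close>; its adjoint version is automatic because \<open>U\<close>
  is unitary. Diagonal operators are reduced by the copy of \<open>H\<close> in degree \<open>0\<close> and stay unitary if they
  were, so the compressions of ordered products are unchanged and the step can be iterated inside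
  \<open>l2(nat, H)\<close>, which is isomorphic to \<open>l2(int, l2(nat, H))\<close>.\<close>

subsection \<open>Complex inner product spaces\<close>

text \<open>Each dilation enlarges the space, and a naive induction would change the type at every
  stage. The tuple is therefore first amplified to \<open>'a l2\<close>; from then on each step maps
  this type to itself, and the final \<open>K\<close> is all of \<open>l2set\<close>, only the
  embedding of H being updated. Three properties of the defect operators enter: their square,
  self-adjointness, and the inheritance of intertwining relations. All three are read off the
  binomial series of sqrt(1 - t), whose coefficients are absolutely summable, so that it also
  converges at operators of norm 1. The phase grows by one power of \<open>w\<close> per degree
  because the dilation is a shift: crossing one degree must cost exactly one factor
  \<open>w\<close>. Where the shift is interrupted by W, its adjoint and the defect operators, the
  relations between V and W balance the phases. The adjoint relations are carried through the
  induction, since the commutation of V with the defect operators in the later steps rests on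
  them.\<close>

lemma scaleC_zero_left [simp]: "0 *\<^sub>C (x::'a::complex_vector) = 0"
  using scaleR_scaleC[of 0 x] by simp

lemma scaleC_zero_right [simp]: "c *\<^sub>C (0::'a::complex_vector) = 0"
  using scaleC_add_right[of c 0 0] by simp

lemma scaleC_minus_right: "c *\<^sub>C (- x::'a::complex_vector) = - (c *\<^sub>C x)"
  using scaleC_add_right[of c x "- x"] by (simp add: eq_neg_iff_add_eq_0 add.commute)

lemma scaleC_diff_right: "c *\<^sub>C (x - y::'a::complex_vector) = c *\<^sub>C x - c *\<^sub>C y"
  using scaleC_add_right[of c x "- y"] by (simp add: scaleC_minus_right)

lemma scaleC_minus_one: "(-1) *\<^sub>C (x::'a::complex_vector) = - x"
  using scaleR_scaleC[of "-1" x] by simp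

declare scaleC_one [simp]

lemma clinear_add: "clinear f \<Longrightarrow> f (x + y) = f x + f y"
  and clinear_scaleC: "clinear f \<Longrightarrow> f (c *\<^sub>C x) = c *\<^sub>C f x"
  by (simp_all add: clinear_def)

lemma clinear_0: "clinear f \<Longrightarrow> f 0 = 0"
  using clinear_scaleC[of f 0 0] by simp

lemma clinear_minus: "clinear f \<Longrightarrow> f (- x) = - f x"
  using clinear_scaleC[of f "-1" x] by (simp add: scaleC_minus_one)

lemma clinear_diff: "clinear f \<Longrightarrow> f (x - y) = f x - f y"
  using clinear_add[of f x "- y"] by (simp add: clinear_minus)

lemma cinner_zero_left [simp]: "cinner 0 (y::'a::complex_inner) = 0"
  using cinner_scaleC_left[of 0 0 y] by simp

lemma cinner_zero_right [simp]: "cinner (x::'a::complex_inner) 0 = 0"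
  using cinner_commute[of x 0] by simp

lemma cinner_add_right: "cinner (x::'a::complex_inner) (y + z) = cinner x y + cinner x z"
  by (metis cinner_add_left cinner_commute complex_cnj_add)

lemma cinner_scaleC_right: "cinner (x::'a::complex_inner) (c *\<^sub>C y) = cnj c * cinner x y"
  by (metis cinner_commute cinner_scaleC_left complex_cnj_mult)

lemma cinner_scaleR_left: "cinner (r *\<^sub>R x) (y::'a::complex_inner) = of_real r * cinner x y"
  by (simp add: scaleR_scaleC cinner_scaleC_left)

lemma cinner_scaleR_right: "cinner (x::'a::complex_inner) (r *\<^sub>R y) = of_real r * cinner x y"
  by (simp add: scaleR_scaleC cinner_scaleC_right)

lemma cinner_minus_left: "cinner (- x) (y::'a::complex_inner) = - cinner x y"
  using cinner_scaleC_left[of "-1" x y] by (simp add: scaleC_minus_one)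

lemma cinner_minus_right: "cinner (x::'a::complex_inner) (- y) = - cinner x y"
  using cinner_scaleC_right[of x "-1" y] by (simp add: scaleC_minus_one)

lemma cinner_diff_left: "cinner (x - y) (z::'a::complex_inner) = cinner x z - cinner y z"
  using cinner_add_left[of x "- y" z] by (simp add: cinner_minus_left)

lemma cinner_diff_right: "cinner (x::'a::complex_inner) (y - z) = cinner x y - cinner x z"
  using cinner_add_right[of x y "- z"] by (simp add: cinner_minus_right)

lemmas cinner_simps = cinner_add_left cinner_add_right cinner_diff_left cinner_diff_right
  cinner_scaleC_left cinner_scaleC_right cinner_minus_left cinner_minus_right

lemma norm_sq_cinner: "(norm (x::'a::complex_inner))\<^sup>2 = Re (cinner x x)"
  using cinner_self_nonneg[of x] by (simp add: norm_eq_sqrt_cinner)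

lemma cinner_self: "cinner (x::'a::complex_inner) x = of_real ((norm x)\<^sup>2)"
  by (rule complex_eqI) (simp_all add: norm_sq_cinner cinner_self_real)

lemma norm_scaleC: "norm (c *\<^sub>C (x::'a::complex_inner)) = cmod c * norm x"
proof -
  have "cinner (c *\<^sub>C x) (c *\<^sub>C x) = (c * cnj c) * cinner x x"
    by (simp add: cinner_scaleC_left cinner_scaleC_right)
  also have "\<dots> = of_real ((cmod c * norm x)\<^sup>2)"
    by (simp only: cinner_self power_mult_distrib of_real_mult complex_norm_square)
  finally have "(norm (c *\<^sub>C x))\<^sup>2 = (cmod c * norm x)\<^sup>2"
    by (simp only: norm_sq_cinner Re_complex_of_real)
  then show ?thesis by (simp add: power2_eq_iff_nonneg)
qed

lemma norm_diff_sq: "(norm (x - y::'a::complex_inner))\<^sup>2 = (norm x)\<^sup>2 + (norm y)\<^sup>2 - 2 * Re (cinner x y)"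
proof -
  have "Re (cinner y x) = Re (cinner x y)" by (subst cinner_commute) simp
  then show ?thesis by (simp add: norm_sq_cinner cinner_simps)
qed

lemma norm_add_sq: "(norm (x + y::'a::complex_inner))\<^sup>2 = (norm x)\<^sup>2 + (norm y)\<^sup>2 + 2 * Re (cinner x y)"
  using norm_diff_sq[of x "- y"] by (simp add: cinner_minus_right)

text \<open>The triangle inequality is available from \<open>real_normed_vector\<close>, so
  Cauchy-Schwarz comes from squaring it, the reverse of the usual deduction.\<close>

lemma Re_cinner_le: "Re (cinner x y) \<le> norm x * norm (y::'a::complex_inner)"
proof -
  have "(norm (x + y))\<^sup>2 \<le> (norm x + norm y)\<^sup>2"
    by (simp add: norm_triangle_ineq power_mono)
  then show ?thesis by (simp add: norm_add_sq power2_sum)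
qed

lemma cmod_cinner_le: "cmod (cinner x y) \<le> norm x * norm (y::'a::complex_inner)"
proof (cases "cinner x y = 0")
  case False
  \<comment> \<open>A unimodular factor that rotates the inner product onto the positive real axis,
    where the bound on real parts applies.\<close>
  define c where "c = cnj (sgn (cinner x y))"
  have c: "cmod c = 1" using False by (simp add: c_def norm_sgn)
  have "c * cinner x y = of_real (cmod (cinner x y))"
  proof -
    have "c * cinner x y = cinner x y * cnj (cinner x y) / of_real (cmod (cinner x y))"
      by (simp add: c_def sgn_eq)
    also have "\<dots> = of_real ((cmod (cinner x y))\<^sup>2) / of_real (cmod (cinner x y))"
      by (simp only: complex_norm_square)
    finally show ?thesis using False by (simp add: power2_eq_square)
  qed
  then have "cmod (cinner x y) = Re (cinner (c *\<^sub>C x) y)" by (simp add: cinner_simps)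
  also have "\<dots> \<le> norm (c *\<^sub>C x) * norm y" by (rule Re_cinner_le)
  finally show ?thesis by (simp add: norm_scaleC c)
qed simp

lemma bounded_linear_cinner_left: "bounded_linear (\<lambda>x. cinner x (y::'a::complex_inner))"
  by (rule bounded_linear_intro[where K = "norm y"])
    (simp_all add: cinner_add_left cinner_scaleR_left cmod_cinner_le scaleR_conv_of_real)

lemma bounded_linear_cinner_right: "bounded_linear (\<lambda>y. cinner (x::'a::complex_inner) y)"
  by (rule bounded_linear_intro[where K = "norm x"])
    (use cmod_cinner_le[of x] in \<open>simp_all add: cinner_add_right cinner_scaleR_right scaleR_conv_of_real mult.commute\<close>)

lemma cinner_eq_imp_eq_right: "(\<And>x. cinner x y = cinner x (z::'a::complex_inner)) \<Longrightarrow> y = z"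
  using cinner_self_eq_zero[of "y - z"] cinner_diff_right[of "y - z" y z] by simp

lemma cinner_eq_imp_eq_left: "(\<And>x. cinner y x = cinner (z::'a::complex_inner) x) \<Longrightarrow> y = z"
  using cinner_self_eq_zero[of "y - z"] cinner_diff_left[of y z "y - z"] by simp

subsection \<open>Adjoints\<close>

text \<open>The representing vector minimises \<open>\<parallel>x\<parallel>\<^sup>2 - 2 Re (f x)\<close>; minimising sequences are Cauchy by
  the parallelogram law.\<close>
lemma riesz_representation:
  fixes f :: "'a::chilbert_space \<Rightarrow> complex"
  assumes add: "\<And>x y. f (x + y) = f x + f y" and scale: "\<And>c x. f (c *\<^sub>C x) = c * f x"
    and bound: "\<And>x. cmod (f x) \<le> M * norm x"
  shows "\<exists>z. \<forall>x. f x = cinner x z"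
proof -
  have scaleR: "f (r *\<^sub>R x) = of_real r * f x" for r x
    by (simp add: scaleR_scaleC scale)
  have bl: "bounded_linear f"
    by (rule bounded_linear_intro[where K = M])
      (simp_all add: add scaleR bound mult.commute[of _ M] scaleR_conv_of_real)
  define \<phi> where "\<phi> x = (norm x)\<^sup>2 - 2 * Re (f x)" for x
  have lower: "- M\<^sup>2 \<le> \<phi> x" for x
  proof -
    have "Re (f x) \<le> M * norm x" using bound[of x] complex_Re_le_cmod[of "f x"] by linarith
    moreover have "0 \<le> (norm x - M)\<^sup>2" by simp
    ultimately show ?thesis by (simp add: \<phi>_def power2_diff algebra_simps)
  qed
  define m where "m = (INF x. \<phi> x)"
  have bdd: "bdd_below (range \<phi>)" by (rule bdd_belowI2) (rule lower)
  have m_le: "m \<le> \<phi> x" for x unfolding m_def by (rule cINF_lower[OF bdd]) simp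
  have ex: "\<exists>x. \<phi> x < m + e" if "0 < e" for e
    using that cINF_less_iff[OF _ bdd, of "m + e"] by (auto simp: m_def)
  define X where "X n = (SOME x. \<phi> x < m + inverse (real (Suc n)))" for n
  have X: "\<phi> (X n) < m + inverse (real (Suc n))" for n
    unfolding X_def by (rule someI_ex, rule ex) simp
  \<comment> \<open>The linear terms of the three values cancel, so the parallelogram law survives
    for \<phi>; bounding the value at the midpoint below by \<open>m\<close> then gives
    \<open>near\<close>.\<close>
  have par: "(norm (x - y))\<^sup>2 = 2 * \<phi> x + 2 * \<phi> y - 4 * \<phi> ((1/2) *\<^sub>R (x + y))" for x y
    by (simp add: \<phi>_def norm_diff_sq norm_add_sq scaleR add power_divide
        cinner_scaleR_left cinner_scaleR_right field_simps del: scaleR_add_right)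
  have near: "(norm (x - y))\<^sup>2 \<le> 2 * (\<phi> x - m) + 2 * (\<phi> y - m)" for x y
    using par[of x y] m_le[of "(1/2) *\<^sub>R (x + y)"] by simp
  have "Cauchy X"
  proof (rule CauchyI)
    fix e :: real assume e: "0 < e"
    then have "0 < e\<^sup>2 / 4" by simp
    then obtain N where N: "inverse (real (Suc N)) < e\<^sup>2 / 4" using reals_Archimedean by blast
    have small: "\<phi> (X n) - m < e\<^sup>2 / 4" if "N \<le> n" for n
    proof -
      have "inverse (real (Suc n)) \<le> inverse (real (Suc N))" using that by (intro le_imp_inverse_le) auto
      then show ?thesis using X[of n] N by linarith
    qed
    have "norm (X a - X b) < e" if "N \<le> a" "N \<le> b" for a b
    proof -
      have "(norm (X a - X b))\<^sup>2 < e\<^sup>2"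
        using near[of "X a" "X b"] small[OF that(1)] small[OF that(2)] by (simp add: field_simps)
      then show ?thesis using e by (simp add: power_less_imp_less_base)
    qed
    then show "\<exists>N. \<forall>a\<ge>N. \<forall>b\<ge>N. norm (X a - X b) < e" by blast
  qed
  then obtain z where z: "X \<longlonglongrightarrow> z" by (meson Cauchy_convergent convergent_def)
  have "(\<lambda>n. \<phi> (X n)) \<longlonglongrightarrow> \<phi> z"
    unfolding \<phi>_def by (intro tendsto_intros bounded_linear.tendsto[OF bl] z)
  moreover have "(\<lambda>n. \<phi> (X n)) \<longlonglongrightarrow> m"
  proof (rule tendsto_sandwich[of "\<lambda>n. m" _ _ "\<lambda>n. m + inverse (real (Suc n))"])
    show "(\<lambda>n. m + inverse (real (Suc n))) \<longlonglongrightarrow> m"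
      using tendsto_add[OF tendsto_const LIMSEQ_inverse_real_of_nat, of m] by simp
  qed (use m_le X in \<open>auto intro!: always_eventually less_imp_le\<close>)
  ultimately have "\<phi> z = m" using LIMSEQ_unique by blast
  then have min: "\<phi> z \<le> \<phi> x" for x using m_le by simp
  have Re_eq: "Re (cinner z v) = Re (f v)" for v
  proof -
    define d where "d = Re (cinner z v) - Re (f v)"
    have quad: "0 \<le> 2 * t * d + t\<^sup>2 * (norm v)\<^sup>2" for t :: real
      using min[of "z + t *\<^sub>R v"]
      by (simp add: \<phi>_def norm_add_sq cinner_scaleR_right add scaleR d_def power_mult_distrib algebra_simps)
    show ?thesis
    proof (cases "norm v = 0")
      case True
      then show ?thesis using scaleR[of 0 v] by simp
    next
      case False
      \<comment> \<open>This \<open>t\<close> minimises the quadratic in \<open>quad\<close>; its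
        minimum is negative unless \<open>d = 0\<close>.\<close>
      have "0 \<le> 2 * (- d / (norm v)\<^sup>2) * d + (- d / (norm v)\<^sup>2)\<^sup>2 * (norm v)\<^sup>2" by (rule quad)
      also have "\<dots> = - (d\<^sup>2 / (norm v)\<^sup>2)" using False by (simp add: field_simps power2_eq_square)
      finally have "d\<^sup>2 / (norm v)\<^sup>2 \<le> 0" by simp
      then have "d = 0" using False by (simp add: divide_le_0_iff)
      then show ?thesis by (simp add: d_def)
    qed
  qed
  have "f v = cinner v z" for v
  proof (rule complex_eqI)
    show "Re (f v) = Re (cinner v z)" using Re_eq[of v] by (subst cinner_commute) simp
    \<comment> \<open>Replacing \<open>v\<close> by \<open>\<i> *\<^sub>C v\<close> turns the
      identity of real parts into one of imaginary parts.\<close>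
    have "Re (cinner z (\<i> *\<^sub>C v)) = Re (f (\<i> *\<^sub>C v))" by (rule Re_eq)
    then have "Im (f v) = - Im (cinner z v)" by (simp add: cinner_simps scale)
    also have "\<dots> = Im (cinner v z)" by (subst cinner_commute) simp
    finally show "Im (f v) = Im (cinner v z)" .
  qed
  then show ?thesis by blast
qed

text \<open>A relation is used because \<open>cadjoint\<close> is a definite description and says
  nothing before existence is known, whereas pairs can be exhibited, reversed and composed;
  \<open>cadjoint_eq\<close> leads back.\<close>

definition adjoint_pair :: "('a::complex_inner \<Rightarrow> 'a) \<Rightarrow> ('a \<Rightarrow> 'a) \<Rightarrow> bool" where
  "adjoint_pair A B \<longleftrightarrow> (\<forall>x y. cinner (A x) y = cinner x (B y))"

lemma adjoint_pairD: "adjoint_pair A B \<Longrightarrow> cinner (A x) y = cinner x (B y)"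
  by (simp add: adjoint_pair_def)

lemma adjoint_pair_sym:
  assumes "adjoint_pair A B"
  shows "adjoint_pair B A"
  unfolding adjoint_pair_def
proof (intro allI)
  fix x y
  have "cinner (B x) y = cnj (cinner y (B x))" by (rule cinner_commute)
  also have "\<dots> = cnj (cinner (A y) x)" by (simp only: adjoint_pairD[OF assms])
  also have "\<dots> = cinner x (A y)" by (rule cinner_commute[symmetric])
  finally show "cinner (B x) y = cinner x (A y)" .
qed

lemma cadjoint_eq:
  assumes "adjoint_pair A B"
  shows "cadjoint A = B"
proof
  fix y
  show "cadjoint A y = B y"
    unfolding cadjoint_def
  proof (rule the_equality)
    show "\<forall>x. cinner (A x) y = cinner x (B y)" by (simp add: adjoint_pairD[OF assms])
    show "z = B y" if "\<forall>x. cinner (A x) y = cinner x z" for z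
      by (rule cinner_eq_imp_eq_right) (simp add: adjoint_pairD[OF assms, symmetric] that)
  qed
qed

text \<open>Inner products separate vectors, so linearity is inherited from the first argument of
  \<open>cinner\<close>. The Schaeffer and defect operators are seen to be linear in this
  way.\<close>

lemma adjoint_pair_clinear:
  assumes "adjoint_pair A B"
  shows "clinear A"
proof -
  have "A (x + y) = A x + A y" for x y
    by (rule cinner_eq_imp_eq_left) (simp add: adjoint_pairD[OF assms] cinner_simps)
  moreover have "A (c *\<^sub>C x) = c *\<^sub>C A x" for c x
    by (rule cinner_eq_imp_eq_left) (simp add: adjoint_pairD[OF assms] cinner_simps)
  ultimately show ?thesis by (simp add: clinear_def)
qed

lemma adjoint_pair_contraction:
  assumes ap: "adjoint_pair A B" and le: "\<And>x. norm (A x) \<le> norm x"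
  shows "norm (B y) \<le> norm y"
proof -
  have "(norm (B y))\<^sup>2 = Re (cinner (A (B y)) y)"
    by (simp add: norm_sq_cinner adjoint_pairD[OF ap])
  also have "\<dots> \<le> norm (A (B y)) * norm y" by (rule Re_cinner_le)
  also have "\<dots> \<le> norm (B y) * norm y" by (simp add: le mult_right_mono)
  finally show ?thesis
    by (cases "norm (B y) = 0") (simp_all add: power2_eq_square)
qed

lemma contraction_bounded_linear:
  assumes "contraction A"
  shows "bounded_linear A"
  using assms by (intro bounded_linear_intro[where K = 1])
    (simp_all add: contraction_def clinear_def scaleR_scaleC)

text \<open>Riesz representation of the functional taking \<open>x\<close> to
  \<open>cinner (A x) y\<close>, for each \<open>y\<close>; completeness enters here.\<close>

lemma contraction_adjoint_pair:
  fixes A :: "'a::chilbert_space \<Rightarrow> 'a"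
  assumes A: "contraction A"
  shows "adjoint_pair A (cadjoint A)"
proof -
  have lin: "clinear A" and le: "norm (A x) \<le> norm x" for x using A by (auto simp: contraction_def)
  have "\<exists>z. \<forall>x. cinner (A x) y = cinner x z" for y
  proof (rule riesz_representation[where M = "norm y"])
    show "cmod (cinner (A x) y) \<le> norm y * norm x" for x
    proof -
      have "cmod (cinner (A x) y) \<le> norm (A x) * norm y" by (rule cmod_cinner_le)
      also have "\<dots> \<le> norm y * norm x" by (subst mult.commute) (simp add: le mult_left_mono)
      finally show ?thesis .
    qed
  qed (simp_all add: clinear_add[OF lin] clinear_scaleC[OF lin] cinner_simps)
  then have "\<exists>B. \<forall>y x. cinner (A x) y = cinner x (B y)" by (intro choice allI)
  then obtain B where B: "adjoint_pair A B" unfolding adjoint_pair_def by blast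
  then show ?thesis by (simp only: cadjoint_eq[OF B])
qed

lemma contraction_cadjoint:
  fixes A :: "'a::chilbert_space \<Rightarrow> 'a"
  assumes A: "contraction A"
  shows "contraction (cadjoint A)"
  unfolding contraction_def
proof (intro conjI allI)
  show "clinear (cadjoint A)"
    by (rule adjoint_pair_clinear[OF adjoint_pair_sym[OF contraction_adjoint_pair[OF A]]])
  show "norm (cadjoint A x) \<le> norm x" for x
    by (rule adjoint_pair_contraction[OF contraction_adjoint_pair[OF A]])
      (use A in \<open>simp add: contraction_def\<close>)
qed

lemma contraction_compose:
  assumes "contraction A" "contraction B"
  shows "contraction (\<lambda>x. A (B x))"
proof -
  have "norm (A (B x)) \<le> norm x" for x
    using assms order_trans[of "norm (A (B x))" "norm (B x)" "norm x"] by (simp add: contraction_def)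
  then show ?thesis using assms by (simp add: contraction_def clinear_def)
qed

lemma adjoint_pair_compose:
  "adjoint_pair A A' \<Longrightarrow> adjoint_pair B B' \<Longrightarrow> adjoint_pair (\<lambda>x. A (B x)) (\<lambda>x. B' (A' x))"
  by (simp add: adjoint_pair_def)

text \<open>Taking adjoints reverses products and conjugates the scalar. With \<open>B\<close>
  itself an adjoint, this carries a double commutation relation from a pair of operators to the
  reversed pair.\<close>

lemma cadjoint_twisted_commute:
  fixes A B :: "'a::complex_inner \<Rightarrow> 'a"
  assumes A: "adjoint_pair A A'" and B: "adjoint_pair B B'"
    and comm: "\<And>x. A (B x) = c *\<^sub>C B (A x)"
  shows "B' (A' y) = cnj c *\<^sub>C A' (B' y)"
proof (rule cinner_eq_imp_eq_right)
  show "cinner x (B' (A' y)) = cinner x (cnj c *\<^sub>C A' (B' y))" for x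
    by (simp add: comm cinner_scaleC_left cinner_scaleC_right
        adjoint_pairD[OF A, symmetric] adjoint_pairD[OF B, symmetric])
qed

subsection \<open>Defect operators\<close>

text \<open>The notation is otherwise ambiguous with that of \<open>Infinite_Sum\<close>.\<close>
no_notation Infinite_Set_Sum.abs_summable_on (infix \<open>abs'_summable'_on\<close> 50)

instance chilbert_space \<subseteq> banach ..

section \<open>Taylor coefficients of sqrt(1 - t) at 0\<close>

definition sqrt_coeff :: "nat \<Rightarrow> real" where
  "sqrt_coeff n = (-1) ^ n * ((1/2) gchoose n)"

text \<open>The series squares to 1 - t: Vandermonde's convolution adds the two exponents 1/2 to the
  exponent 1.\<close>

lemma sqrt_coeff_convolution:
  "(\<Sum>i\<le>n. sqrt_coeff i * sqrt_coeff (n - i)) = (if n = 0 then 1 else if n = 1 then -1 else 0)"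
proof -
  have "(\<Sum>i\<le>n. sqrt_coeff i * sqrt_coeff (n - i))
      = (\<Sum>i\<le>n. (-1) ^ n * (((1/2) gchoose i) * ((1/2) gchoose (n - i))))"
  proof (rule sum.cong)
    fix i assume "i \<in> {..n}"
    then have "(-1) ^ i * (-1) ^ (n - i) = ((-1) ^ n :: real)"
      by (simp flip: power_add)
    then show "sqrt_coeff i * sqrt_coeff (n - i)
        = (-1) ^ n * (((1/2) gchoose i) * ((1/2) gchoose (n - i)))"
      by (simp add: sqrt_coeff_def mult.assoc mult.left_commute)
  qed simp
  also have "\<dots> = (-1) ^ n * ((1/2 + 1/2 :: real) gchoose n)"
    unfolding gbinomial_Vandermonde[symmetric] by (simp add: sum_distrib_left atLeast0AtMost)
  also have "\<dots> = (-1) ^ n * of_nat (1 choose n)"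
    by (simp add: binomial_gbinomial)
  also have "\<dots> = (if n = 0 then 1 else if n = 1 then -1 else 0)"
    by (cases n) (auto simp: binomial_eq_0)
  finally show ?thesis .
qed

text \<open>Only the coefficient of index 0 is positive, so a partial sum of absolute values is 2
  minus the partial sum of the coefficients. The latter is, up to sign, a binomial coefficient with
  upper entry -1/2, and it is nonnegative.\<close>

lemma summable_sqrt_coeff: "summable (\<lambda>n. \<bar>sqrt_coeff n\<bar>)"
proof -
  have coeff: "sqrt_coeff n = pochhammer (- (1/2)) n / fact n" for n
    by (simp add: sqrt_coeff_def gbinomial_pochhammer flip: power_mult_distrib)
  have abs: "\<bar>sqrt_coeff n\<bar> = (if n = 0 then 2 else 0) - sqrt_coeff n" for n
  proof (cases n)
    case 0
    then show ?thesis by (simp add: sqrt_coeff_def)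
  next
    case (Suc m)
    have "0 \<le> pochhammer (1/2::real) m" by (rule pochhammer_nonneg) simp
    then have "sqrt_coeff n \<le> 0"
      by (simp add: coeff Suc pochhammer_rec divide_le_0_iff)
    then show ?thesis by (simp add: Suc)
  qed
  show ?thesis
  proof (rule bounded_imp_summable[where B = 2])
    fix n
    have "(\<Sum>k\<le>n. sqrt_coeff k) = (-1) ^ n * ((1/2 - 1) gchoose n)"
      unfolding gbinomial_sum_lower_neg[symmetric] by (simp add: sqrt_coeff_def mult.commute)
    also have "\<dots> = pochhammer (1/2) n / fact n"
      by (simp add: gbinomial_pochhammer flip: power_mult_distrib)
    finally have "0 \<le> (\<Sum>k\<le>n. sqrt_coeff k)"
      by (simp add: pochhammer_nonneg)
    then show "(\<Sum>k\<le>n. \<bar>sqrt_coeff k\<bar>) \<le> 2"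
      by (simp add: abs sum_subtractf)
  qed simp
qed

text \<open>The binomial series of \<open>(1 - A) powr (1/2)\<close>.\<close>
definition defect :: "('a::chilbert_space \<Rightarrow> 'a) \<Rightarrow> 'a \<Rightarrow> 'a" where
  "defect A x = (\<Sum>\<^sub>\<infinity>n. sqrt_coeff n *\<^sub>R (A ^^ n) x)"

section \<open>The square root series evaluated at a contraction\<close>

lemma contraction_funpow: "contraction A \<Longrightarrow> norm ((A ^^ n) x) \<le> norm x"
proof (induction n)
  case (Suc n)
  then show ?case using order_trans[of "norm (A ((A ^^ n) x))" "norm ((A ^^ n) x)"]
    by (simp add: contraction_def)
qed simp

lemma abs_summable_sqrt_coeff: "sqrt_coeff abs_summable_on UNIV"
  using norm_summable_imp_summable_on[of "\<lambda>n. norm (sqrt_coeff n)"] summable_sqrt_coeff by simp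

lemma summable_defect:
  assumes A: "contraction A"
  shows "(\<lambda>n. sqrt_coeff n *\<^sub>R (A ^^ n) (x::'a::chilbert_space)) summable_on UNIV"
proof (rule Infinite_Sum.abs_summable_summable, rule Infinite_Sum.abs_summable_on_comparison_test)
  show "(\<lambda>n. sqrt_coeff n * norm x) abs_summable_on UNIV"
    using summable_on_cmult_left[OF abs_summable_sqrt_coeff, of "norm x"] by (simp add: abs_mult)
  show "norm (sqrt_coeff n *\<^sub>R (A ^^ n) x) \<le> norm (sqrt_coeff n * norm x)" for n
    using contraction_funpow[OF A, of n x] by (simp add: abs_mult mult_left_mono)
qed

lemma has_sum_defect:
  "contraction A \<Longrightarrow> ((\<lambda>n. sqrt_coeff n *\<^sub>R (A ^^ n) x) has_sum defect A x) UNIV"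
  unfolding defect_def by (intro has_sum_infsum summable_defect)

text \<open>The relation passes to powers and, by continuity of \<open>B\<close>, to the series. It
  is used with \<open>A = A'\<close> for operators commuting with \<open>A\<close>, and with
  \<open>A\<close>, \<open>A'\<close> the two products of W and its adjoint to move W across the
  defect operators.\<close>

lemma defect_intertwine:
  assumes A: "contraction A" and A': "contraction A'" and B: "bounded_linear B"
    and comm: "\<And>x. B (A x) = A' (B x)"
  shows "B (defect A x) = defect A' (B x)"
proof -
  interpret B: bounded_linear B by fact
  have pow: "B ((A ^^ n) x) = (A' ^^ n) (B x)" for n
    by (induction n) (simp_all add: comm)
  have "((\<lambda>n. B (sqrt_coeff n *\<^sub>R (A ^^ n) x)) has_sum B (defect A x)) UNIV"
    by (rule has_sum_bounded_linear[OF B has_sum_defect[OF A]])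
  then have "((\<lambda>n. sqrt_coeff n *\<^sub>R (A' ^^ n) (B x)) has_sum B (defect A x)) UNIV"
    by (simp add: B.scaleR pow)
  then show ?thesis using has_sum_defect[OF A'] has_sum_unique by blast
qed

lemma defect_selfadjoint:
  assumes A: "contraction A" and sa: "adjoint_pair A A"
  shows "adjoint_pair (defect A) (defect A)"
  unfolding adjoint_pair_def
proof (intro allI)
  fix x y
  have pow: "cinner ((A ^^ n) x) y = cinner x ((A ^^ n) y)" for n
    by (induction n arbitrary: x y) (simp_all add: adjoint_pairD[OF sa] flip: funpow_swap1)
  have "((\<lambda>n. cinner (sqrt_coeff n *\<^sub>R (A ^^ n) x) y) has_sum cinner (defect A x) y) UNIV"
    by (rule has_sum_bounded_linear[OF bounded_linear_cinner_left has_sum_defect[OF A]])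
  moreover have "((\<lambda>n. cinner x (sqrt_coeff n *\<^sub>R (A ^^ n) y)) has_sum cinner x (defect A y)) UNIV"
    by (rule has_sum_bounded_linear[OF bounded_linear_cinner_right has_sum_defect[OF A]])
  ultimately show "cinner (defect A x) y = cinner x (defect A y)"
    using has_sum_unique by (auto simp: cinner_scaleR_left cinner_scaleR_right pow)
qed

text \<open>A Cauchy product: absolute convergence allows the double series to be summed along the
  diagonals \<open>i + j = n\<close>, where the operator is always \<open>A ^^ n\<close> and the
  scalars add up to the convolution of the coefficients.\<close>

lemma defect_square:
  fixes A :: "'a::chilbert_space \<Rightarrow> 'a"
  assumes A: "contraction A"
  shows "defect A (defect A x) = x - A x"
proof -
  have bl: "bounded_linear (A ^^ i)" for i
  proof (induction i)
    case (Suc i)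
    from bounded_linear_compose[OF contraction_bounded_linear[OF A] this]
    show ?case by (simp add: o_def)
  qed (simp add: bounded_linear_ident id_def)
  define g where "g = (\<lambda>(i, j). (sqrt_coeff i * sqrt_coeff j) *\<^sub>R (A ^^ (i + j)) x)"
  have "(\<lambda>(i, j). sqrt_coeff i * sqrt_coeff j) abs_summable_on UNIV \<times> UNIV"
  proof (subst Infinite_Sum.abs_summable_on_Sigma_iff, intro conjI ballI)
    show "(\<lambda>j. (\<lambda>(i, j). sqrt_coeff i * sqrt_coeff j) (i, j)) abs_summable_on UNIV" for i
      using summable_on_cmult_right[OF abs_summable_sqrt_coeff, of "\<bar>sqrt_coeff i\<bar>"]
      by (simp add: abs_mult)
    show "(\<lambda>i. \<Sum>\<^sub>\<infinity>j. norm ((\<lambda>(i, j). sqrt_coeff i * sqrt_coeff j) (i, j))) abs_summable_on UNIV"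
      using summable_on_cmult_left[OF abs_summable_sqrt_coeff, of "\<bar>\<Sum>\<^sub>\<infinity>j. \<bar>sqrt_coeff j\<bar>\<bar>"]
      by (simp add: abs_mult infsum_cmult_right')
  qed
  from summable_on_cmult_left[OF this, of "norm x"]
  have bound: "(\<lambda>(i, j). (sqrt_coeff i * sqrt_coeff j) * norm x) abs_summable_on UNIV \<times> UNIV"
    by (simp add: case_prod_unfold abs_mult)
  have "g abs_summable_on UNIV \<times> UNIV"
  proof (rule Infinite_Sum.abs_summable_on_comparison_test[OF bound])
    fix p :: "nat \<times> nat"
    show "norm (g p) \<le> norm (case p of (i, j) \<Rightarrow> (sqrt_coeff i * sqrt_coeff j) * norm x)"
      using contraction_funpow[OF A, of "fst p + snd p" x]
      by (simp add: g_def case_prod_unfold abs_mult mult_left_mono)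
  qed
  then have g: "g summable_on UNIV \<times> UNIV" by (rule Infinite_Sum.abs_summable_summable)
  have "defect A (defect A x) = (\<Sum>\<^sub>\<infinity>i. \<Sum>\<^sub>\<infinity>j. g (i, j))"
  proof -
    have "sqrt_coeff i *\<^sub>R (A ^^ i) (defect A x) = (\<Sum>\<^sub>\<infinity>j. g (i, j))" for i
    proof -
      interpret bounded_linear "A ^^ i" by (rule bl)
      have "((\<lambda>j. sqrt_coeff i *\<^sub>R (A ^^ i) (sqrt_coeff j *\<^sub>R (A ^^ j) x))
          has_sum sqrt_coeff i *\<^sub>R (A ^^ i) (defect A x)) UNIV"
        by (intro has_sum_scaleR has_sum_bounded_linear[OF bl] has_sum_defect A)
      then show ?thesis
        by (simp add: g_def scaleR funpow_add infsumI)
    qed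
    then show ?thesis by (simp add: defect_def[of A "defect A x"])
  qed
  also have "\<dots> = infsum g (UNIV \<times> UNIV)"
    by (rule infsum_Sigma_banach[OF g])
  also have "\<dots> = infsum (\<lambda>p. g (snd p, fst p - snd p)) (SIGMA n:UNIV. {..n})"
    by (rule infsum_reindex_bij_witness[of _ "\<lambda>(n, i). (i, n - i)" "\<lambda>(i, j). (i + j, i)"]) auto
  also have "\<dots> = (\<Sum>\<^sub>\<infinity>n. \<Sum>\<^sub>\<infinity>i\<in>{..n}. g (i, n - i))"
  proof -
    have "(\<lambda>p. g (snd p, fst p - snd p)) summable_on (SIGMA n:UNIV. {..n})"
      using g by (subst summable_on_reindex_bij_witness[of _ "\<lambda>(i, j). (i + j, i)" "\<lambda>(n, i). (i, n - i)"
            "UNIV \<times> UNIV" g]) auto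
    from infsum_Sigma_banach[OF this] show ?thesis by simp
  qed
  also have "\<dots> = (\<Sum>\<^sub>\<infinity>n. (if n = 0 then 1 else if n = 1 then -1 else 0) *\<^sub>R (A ^^ n) x)"
  proof (rule infsum_cong)
    fix n
    have "(\<Sum>\<^sub>\<infinity>i\<in>{..n}. g (i, n - i)) = (\<Sum>i\<le>n. (sqrt_coeff i * sqrt_coeff (n - i)) *\<^sub>R (A ^^ n) x)"
      by (simp add: g_def)
    also have "\<dots> = (\<Sum>i\<le>n. sqrt_coeff i * sqrt_coeff (n - i)) *\<^sub>R (A ^^ n) x"
      by (simp add: scaleR_left.sum)
    finally show "(\<Sum>\<^sub>\<infinity>i\<in>{..n}. g (i, n - i))
        = (if n = 0 then 1 else if n = 1 then -1 else 0) *\<^sub>R (A ^^ n) x"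
      by (simp only: sqrt_coeff_convolution)
  qed
  also have "\<dots> = (\<Sum>\<^sub>\<infinity>n\<in>{0, 1}. (if n = 0 then 1 else if n = 1 then -1 else 0) *\<^sub>R (A ^^ n) x)"
    by (rule infsum_cong_neutral) auto
  also have "\<dots> = x - A x" by simp
  finally show ?thesis .
qed

subsection \<open>Square-summable sequences as a Hilbert space\<close>

lemma l2set_iff: "f \<in> l2set \<longleftrightarrow> summable (\<lambda>n. (norm (f n))\<^sup>2)"
  by (simp add: l2set_def)

text \<open>Minkowski's inequality for finite sections, with a bound independent of the section,
  yields both summability and the estimate for the full sums.\<close>

lemma l2set_add_aux:
  fixes f g :: "nat \<Rightarrow> 'a::complex_inner"
  assumes f: "f \<in> l2set" and g: "g \<in> l2set"
  shows "(\<lambda>n. f n + g n) \<in> l2set"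
    and "sqrt (\<Sum>n. (norm (f n + g n))\<^sup>2) \<le> sqrt (\<Sum>n. (norm (f n))\<^sup>2) + sqrt (\<Sum>n. (norm (g n))\<^sup>2)"
proof -
  let ?B = "sqrt (\<Sum>n. (norm (f n))\<^sup>2) + sqrt (\<Sum>n. (norm (g n))\<^sup>2)"
  have L2: "L2_set (\<lambda>n. norm (h n)) {..<N} \<le> sqrt (\<Sum>n. (norm (h n))\<^sup>2)"
    if "h \<in> l2set" for h :: "nat \<Rightarrow> 'a" and N
    using that unfolding L2_set_def by (intro real_sqrt_le_mono sum_le_suminf) (auto simp: l2set_iff)
  have B0: "0 \<le> ?B" by (intro add_nonneg_nonneg real_sqrt_ge_zero suminf_nonneg) (use f g in \<open>auto simp: l2set_iff\<close>)
  have bound: "(\<Sum>n<N. (norm (f n + g n))\<^sup>2) \<le> ?B\<^sup>2" for N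
  proof -
    have "L2_set (\<lambda>n. norm (f n + g n)) {..<N} \<le> L2_set (\<lambda>n. norm (f n) + norm (g n)) {..<N}"
      by (intro L2_set_mono norm_triangle_ineq) auto
    also have "\<dots> \<le> L2_set (\<lambda>n. norm (f n)) {..<N} + L2_set (\<lambda>n. norm (g n)) {..<N}"
      by (rule L2_set_triangle_ineq)
    also have "\<dots> \<le> ?B" by (intro add_mono L2 f g)
    finally show ?thesis unfolding L2_set_def by (rule sqrt_le_D)
  qed
  then have sm: "summable (\<lambda>n. (norm (f n + g n))\<^sup>2)"
    by (intro summableI_nonneg_bounded) auto
  then show "(\<lambda>n. f n + g n) \<in> l2set" by (simp add: l2set_iff)
  have "(\<Sum>n. (norm (f n + g n))\<^sup>2) \<le> ?B\<^sup>2"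
    by (rule suminf_le_const[OF sm bound])
  then show "sqrt (\<Sum>n. (norm (f n + g n))\<^sup>2) \<le> ?B"
    using B0 by (rule real_le_lsqrt[rotated])
qed

lemma l2set_scaleC: "f \<in> l2set \<Longrightarrow> (\<lambda>n. c *\<^sub>C f n) \<in> l2set"
  by (simp add: l2set_iff norm_scaleC power_mult_distrib summable_mult)

lemma l2set_zero: "(\<lambda>n. 0) \<in> l2set"
  by (simp add: l2set_iff)

lemma summable_cinner:
  assumes "f \<in> l2set" "g \<in> l2set"
  shows "summable (\<lambda>n. norm (cinner (f n) (g n)))"
proof (rule summable_comparison_test')
  show "summable (\<lambda>n. (norm (f n))\<^sup>2 + (norm (g n))\<^sup>2)"
    using assms by (intro summable_add) (simp_all add: l2set_iff)
  fix n
  have "norm (f n) * norm (g n) \<le> (norm (f n))\<^sup>2 + (norm (g n))\<^sup>2"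
    using zero_le_power2[of "norm (f n) - norm (g n)"] mult_nonneg_nonneg[of "norm (f n)" "norm (g n)"]
    unfolding power2_diff by (simp del: mult_nonneg_nonneg)
  then show "norm (norm (cinner (f n) (g n))) \<le> (norm (f n))\<^sup>2 + (norm (g n))\<^sup>2"
    using cmod_cinner_le[of "f n" "g n"] by simp
qed

lemma sums_l2inner:
  "f \<in> l2set \<Longrightarrow> g \<in> l2set \<Longrightarrow> (\<lambda>n. cinner (f n) (g n)) sums l2inner f g"
  unfolding l2inner_def by (intro summable_sums summable_norm_cancel[OF summable_cinner])

lemma l2norm_eq:
  assumes "f \<in> l2set"
  shows "l2norm f = sqrt (\<Sum>n. (norm (f n))\<^sup>2)"
  unfolding l2norm_def
  using sums_Re[OF sums_l2inner[OF assms assms]] by (simp add: sums_iff norm_sq_cinner)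

text \<open>As a type, the sequence space can be made an instance of \<open>chilbert_space\<close>,
  so the results on adjoints and defect operators apply to operators on it.\<close>

typedef (overloaded) 'a l2 = "l2set :: (nat \<Rightarrow> 'a::complex_inner) set"
  using l2set_zero by blast

setup_lifting type_definition_l2

instantiation l2 :: (complex_inner) complex_vector
begin

lift_definition zero_l2 :: "'a l2" is "\<lambda>n. 0" by (rule l2set_zero)
lift_definition plus_l2 :: "'a l2 \<Rightarrow> 'a l2 \<Rightarrow> 'a l2" is "\<lambda>f g n. f n + g n"
  by (rule l2set_add_aux)
lift_definition uminus_l2 :: "'a l2 \<Rightarrow> 'a l2" is "\<lambda>f n. - f n"
  by (simp add: l2set_iff)
lift_definition minus_l2 :: "'a l2 \<Rightarrow> 'a l2 \<Rightarrow> 'a l2" is "\<lambda>f g n. f n - g n"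
proof -
  fix f g :: "nat \<Rightarrow> 'a" assume "f \<in> l2set" "g \<in> l2set"
  then show "(\<lambda>n. f n - g n) \<in> l2set"
    using l2set_add_aux(1)[of f "\<lambda>n. - g n"] by (simp add: l2set_iff)
qed
lift_definition scaleC_l2 :: "complex \<Rightarrow> 'a l2 \<Rightarrow> 'a l2" is "\<lambda>c f n. c *\<^sub>C f n"
  by (rule l2set_scaleC)
lift_definition scaleR_l2 :: "real \<Rightarrow> 'a l2 \<Rightarrow> 'a l2" is "\<lambda>r f n. r *\<^sub>R f n"
  by (simp only: scaleR_scaleC l2set_scaleC)

instance
  by standard (transfer; simp add: fun_eq_iff algebra_simps scaleC_add_right scaleC_add_left
      scaleC_scaleC scaleR_scaleC)+

end

instantiation l2 :: (complex_inner) complex_inner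
begin

lift_definition cinner_l2 :: "'a l2 \<Rightarrow> 'a l2 \<Rightarrow> complex" is l2inner .
lift_definition norm_l2 :: "'a l2 \<Rightarrow> real" is l2norm .
definition "dist x y = norm (x - y)" for x y :: "'a l2"
definition "sgn x = inverse (norm x) *\<^sub>R x" for x :: "'a l2"
definition "uniformity = (INF e\<in>{0<..}. principal {(x::'a l2, y). dist x y < e})"
definition "open U \<longleftrightarrow> (\<forall>x\<in>U. eventually (\<lambda>(x', y). x' = x \<longrightarrow> y \<in> U) uniformity)" for U :: "'a l2 set"

instance
proof
  fix x y z :: "'a l2" and a :: complex and r :: real and U :: "'a l2 set"
  show "dist x y = norm (x - y)" by (rule dist_l2_def)
  show "sgn x = inverse (norm x) *\<^sub>R x" by (rule sgn_l2_def)
  show "uniformity = (INF e\<in>{0<..}. principal {(x::'a l2, y). dist x y < e})"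
    by (rule uniformity_l2_def)
  show "open U \<longleftrightarrow> (\<forall>x\<in>U. eventually (\<lambda>(x', y). x' = x \<longrightarrow> y \<in> U) uniformity)"
    by (rule open_l2_def)
  show zero_iff: "norm x = 0 \<longleftrightarrow> x = 0"
  proof transfer
    fix f :: "nat \<Rightarrow> 'a" assume f: "f \<in> l2set"
    then show "l2norm f = 0 \<longleftrightarrow> f = (\<lambda>n. 0)"
      by (auto simp: l2norm_eq suminf_eq_zero_iff l2set_iff fun_eq_iff)
  qed
  show "norm (x + y) \<le> norm x + norm y"
    by transfer (simp add: l2norm_eq l2set_add_aux)
  show "norm (r *\<^sub>R x) = \<bar>r\<bar> * norm x"
  proof transfer
    fix r and f :: "nat \<Rightarrow> 'a" assume f: "f \<in> l2set"
    then have "(\<lambda>n. r *\<^sub>R f n) \<in> l2set" by (simp only: scaleR_scaleC l2set_scaleC)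
    with f show "l2norm (\<lambda>n. r *\<^sub>R f n) = \<bar>r\<bar> * l2norm f"
      by (simp add: l2norm_eq power_mult_distrib suminf_mult l2set_iff real_sqrt_mult)
  qed
  have sq: "cinner x x = of_real (\<Sum>n. (norm (Rep_l2 x n))\<^sup>2)" for x :: "'a l2"
  proof transfer
    fix f :: "nat \<Rightarrow> 'a" assume "f \<in> l2set"
    then show "l2inner f f = of_real (\<Sum>n. (norm (f n))\<^sup>2)"
      by (simp add: l2inner_def cinner_self l2set_iff suminf_of_real)
  qed
  show "cinner x y = cnj (cinner y x)"
  proof transfer
    fix f g :: "nat \<Rightarrow> 'a" assume "f \<in> l2set" "g \<in> l2set"
    then have "(\<lambda>n. cnj (cinner (g n) (f n))) sums cnj (l2inner g f)"
      unfolding sums_cnj by (rule sums_l2inner[rotated])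
    moreover have "(\<lambda>n. cnj (cinner (g n) (f n))) = (\<lambda>n. cinner (f n) (g n))"
      by (rule ext) (rule cinner_commute[symmetric])
    ultimately show "l2inner f g = cnj (l2inner g f)"
      by (simp add: l2inner_def[of f g] sums_iff)
  qed
  show "cinner (x + y) z = cinner x z + cinner y z"
  proof transfer
    fix f g h :: "nat \<Rightarrow> 'a" assume "f \<in> l2set" "g \<in> l2set" "h \<in> l2set"
    then show "l2inner (\<lambda>n. f n + g n) h = l2inner f h + l2inner g h"
      using sums_add[OF sums_l2inner sums_l2inner, of f h g h]
      by (simp add: l2inner_def[of _ h] cinner_add_left sums_iff)
  qed
  show "cinner (a *\<^sub>C x) y = a * cinner x y"
  proof transfer
    fix a and f g :: "nat \<Rightarrow> 'a" assume "f \<in> l2set" "g \<in> l2set"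
    then show "l2inner (\<lambda>n. a *\<^sub>C f n) g = a * l2inner f g"
      using sums_mult[OF sums_l2inner, of f g a]
      by (simp add: l2inner_def[of "\<lambda>n. a *\<^sub>C f n"] cinner_scaleC_left sums_iff)
  qed
  show "Im (cinner x x) = 0" by (simp add: sq)
  have nonneg: "0 \<le> (\<Sum>n. (norm (Rep_l2 x n))\<^sup>2)"
    using Rep_l2[of x] by (intro suminf_nonneg) (auto simp: l2set_iff)
  then show "0 \<le> Re (cinner x x)" by (simp add: sq)
  show norm: "norm x = sqrt (Re (cinner x x))"
    by transfer (rule l2norm_def)
  show "cinner x x = 0 \<longleftrightarrow> x = 0"
    using nonneg zero_iff norm by (simp add: sq)
qed

end

lemma Rep_l2_summable: "summable (\<lambda>n. (norm (Rep_l2 x n))\<^sup>2)"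
  using Rep_l2[of x] by (simp add: l2set_iff)

lemma norm_l2_sq: "(norm x)\<^sup>2 = (\<Sum>n. (norm (Rep_l2 x n))\<^sup>2)"
proof -
  have "norm x = sqrt (\<Sum>n. (norm (Rep_l2 x n))\<^sup>2)"
    by transfer (rule l2norm_eq)
  then show ?thesis by (simp add: suminf_nonneg Rep_l2_summable)
qed

lemma norm_Rep_l2_le: "norm (Rep_l2 x n) \<le> norm x"
proof -
  have "(norm (Rep_l2 x n))\<^sup>2 \<le> (norm x)\<^sup>2"
    using sum_le_suminf[OF Rep_l2_summable, of "{n}" x] by (simp add: norm_l2_sq)
  then show ?thesis by simp
qed

text \<open>The limit \<open>y\<close> is taken coordinatewise. Letting \<open>b\<close> tend to
  infinity in the Cauchy estimate bounds all finite sections of \<open>X a - y\<close> uniformly;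
  \<open>y\<close> is then square-summable as \<open>X a\<close> minus this difference.\<close>

instance l2 :: (chilbert_space) chilbert_space
proof
  fix X :: "nat \<Rightarrow> 'a l2" assume X: "Cauchy X"
  have "Cauchy (\<lambda>m. Rep_l2 (X m) n)" for n
  proof (rule CauchyI)
    fix e :: real assume "0 < e"
    from CauchyD[OF X this] obtain M where M: "\<And>a b. M \<le> a \<Longrightarrow> M \<le> b \<Longrightarrow> norm (X a - X b) < e"
      by blast
    have "norm (Rep_l2 (X a) n - Rep_l2 (X b) n) < e" if "M \<le> a" "M \<le> b" for a b
      using norm_Rep_l2_le[of "X a - X b" n] M[OF that] by (simp add: minus_l2.rep_eq)
    then show "\<exists>M. \<forall>a\<ge>M. \<forall>b\<ge>M. norm (Rep_l2 (X a) n - Rep_l2 (X b) n) < e" by blast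
  qed
  then have "\<exists>y. \<forall>n. (\<lambda>m. Rep_l2 (X m) n) \<longlonglongrightarrow> y n"
    by (intro choice allI) (auto simp: Cauchy_convergent_iff convergent_def)
  then obtain y where y: "\<And>n. (\<lambda>m. Rep_l2 (X m) n) \<longlonglongrightarrow> y n" by blast
  have tail: "\<exists>M. \<forall>a\<ge>M. \<forall>N. (\<Sum>n<N. (norm (Rep_l2 (X a) n - y n))\<^sup>2) \<le> e\<^sup>2" if "0 < e" for e
  proof -
    from CauchyD[OF X that] obtain M where M: "\<And>a b. M \<le> a \<Longrightarrow> M \<le> b \<Longrightarrow> norm (X a - X b) < e"
      by blast
    have "(\<Sum>n<N. (norm (Rep_l2 (X a) n - y n))\<^sup>2) \<le> e\<^sup>2" if a: "M \<le> a" for a N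
    proof (rule LIMSEQ_le_const2)
      show "(\<lambda>b. \<Sum>n<N. (norm (Rep_l2 (X a) n - Rep_l2 (X b) n))\<^sup>2)
          \<longlonglongrightarrow> (\<Sum>n<N. (norm (Rep_l2 (X a) n - y n))\<^sup>2)"
        by (intro tendsto_intros y)
      have "(\<Sum>n<N. (norm (Rep_l2 (X a) n - Rep_l2 (X b) n))\<^sup>2) \<le> e\<^sup>2" if "M \<le> b" for b
      proof -
        have "(\<Sum>n<N. (norm (Rep_l2 (X a - X b) n))\<^sup>2) \<le> (norm (X a - X b))\<^sup>2"
          unfolding norm_l2_sq by (intro sum_le_suminf Rep_l2_summable) auto
        also have "\<dots> \<le> e\<^sup>2" using M[OF a that] by (intro power_mono) auto
        finally show ?thesis by (simp add: minus_l2.rep_eq)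
      qed
      then show "\<exists>M. \<forall>b\<ge>M. (\<Sum>n<N. (norm (Rep_l2 (X a) n - Rep_l2 (X b) n))\<^sup>2) \<le> e\<^sup>2" by blast
    qed
    then show ?thesis by blast
  qed
  have diff: "(\<lambda>n. Rep_l2 (X a) n - y n) \<in> l2set"
    if "\<And>N. (\<Sum>n<N. (norm (Rep_l2 (X a) n - y n))\<^sup>2) \<le> e\<^sup>2" for a e
    unfolding l2set_iff by (rule summableI_nonneg_bounded[OF _ that]) simp
  from tail[OF zero_less_one] obtain a where "\<And>N. (\<Sum>n<N. (norm (Rep_l2 (X a) n - y n))\<^sup>2) \<le> 1\<^sup>2"
    by blast
  from diff[OF this] have d: "(\<lambda>n. Rep_l2 (X a) n - y n) \<in> l2set" .
  have y_l2: "y \<in> l2set"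
    using Rep_l2[of "X a - Abs_l2 (\<lambda>n. Rep_l2 (X a) n - y n)"] d
    by (simp add: minus_l2.rep_eq Abs_l2_inverse)
  have "X \<longlonglongrightarrow> Abs_l2 y"
  proof (rule LIMSEQ_I)
    fix e :: real assume "0 < e"
    then have "0 < e/2" by simp
    from tail[OF this] obtain M where M: "\<And>a N. M \<le> a \<Longrightarrow> (\<Sum>n<N. (norm (Rep_l2 (X a) n - y n))\<^sup>2) \<le> (e/2)\<^sup>2"
      by blast
    have "norm (X a - Abs_l2 y) < e" if "M \<le> a" for a
    proof -
      have "(norm (X a - Abs_l2 y))\<^sup>2 \<le> (e/2)\<^sup>2"
        unfolding norm_l2_sq using M[OF that]
        by (intro suminf_le_const Rep_l2_summable) (simp add: minus_l2.rep_eq Abs_l2_inverse y_l2)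
      then have "norm (X a - Abs_l2 y) \<le> e/2" using \<open>0 < e\<close> by (simp add: power2_le_iff_abs_le)
      then show ?thesis using \<open>0 < e\<close> by simp
    qed
    then show "\<exists>M. \<forall>a\<ge>M. norm (X a - Abs_l2 y) < e" by blast
  qed
  then show "convergent X" by (auto simp: convergent_def)
qed

subsection \<open>The grading of a sequence space by the integers\<close>

text \<open>Splitting the index set \<open>nat\<close> into copies of itself, one for each integer, identifies
  \<open>l2(nat, H)\<close> with \<open>l2(int, l2(nat, H))\<close>.\<close>
definition graded_index :: "int \<times> nat \<Rightarrow> nat" where
  "graded_index = (\<lambda>(z, n). prod_encode (int_encode z, n))"

lemma bij_graded_index: "bij graded_index"
proof -
  have "bij_betw (map_prod int_encode (\<lambda>n::nat. n)) (UNIV \<times> UNIV) (UNIV \<times> UNIV)"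
    by (rule bij_betw_map_prod[OF bij_int_encode]) (simp add: bij_betw_def)
  then have "bij (prod_encode \<circ> map_prod int_encode (\<lambda>n. n))"
    using bij_prod_encode by (intro bij_comp) simp_all
  moreover have "prod_encode \<circ> map_prod int_encode (\<lambda>n. n) = graded_index"
    by (auto simp: graded_index_def)
  ultimately show ?thesis by simp
qed

lemma l2set_iff_summable_on: "f \<in> l2set \<longleftrightarrow> (\<lambda>n. (norm (f n))\<^sup>2) summable_on UNIV"
  by (simp add: l2set_iff summable_on_UNIV_nonneg_real_iff)

lemma l2set_graded_iff:
  "f \<in> l2set \<longleftrightarrow> (\<lambda>p. (norm (f (graded_index p)))\<^sup>2) summable_on UNIV"
  unfolding l2set_iff_summable_on
  by (rule summable_on_reindex_bij_betw[OF bij_graded_index, symmetric])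

lemma l2set_component:
  assumes "f \<in> l2set"
  shows "(\<lambda>n. f (graded_index (z, n))) \<in> l2set"
proof -
  have "(\<lambda>p. (norm (f (graded_index p)))\<^sup>2) summable_on Pair z ` UNIV"
    using assms unfolding l2set_graded_iff by (rule summable_on_subset_banach) simp
  then show ?thesis
    unfolding l2set_iff_summable_on by (subst (asm) summable_on_reindex) (auto simp: inj_on_def o_def)
qed

lift_definition component :: "int \<Rightarrow> 'a::complex_inner l2 \<Rightarrow> 'a l2" is
  "\<lambda>z f n. f (graded_index (z, n))"
  by (rule l2set_component)

lemma component_add: "component z (f + g) = component z f + component z g"
  by transfer simp

lemma component_scaleC: "component z (c *\<^sub>C f) = c *\<^sub>C component z f"
  by transfer simp

lemma component_eqI:
  assumes "\<And>z. component z f = component z g"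
  shows "f = g"
proof -
  have "Rep_l2 f (graded_index (z, n)) = Rep_l2 g (graded_index (z, n))" for z n
    using assms[of z] by (metis component.rep_eq)
  then have "Rep_l2 f m = Rep_l2 g m" for m
    using bij_is_surj[OF bij_graded_index] by (metis surjE surj_pair)
  then show ?thesis by (metis Rep_l2_inject ext)
qed

lemma has_sum_l2inner:
  assumes "f \<in> l2set" "g \<in> l2set"
  shows "((\<lambda>n. cinner (f n) (g n)) has_sum l2inner f g) UNIV"
  by (rule norm_summable_imp_has_sum[OF summable_cinner[OF assms] sums_l2inner[OF assms]])

text \<open>The sum is grouped by the blocks of \<open>graded_index\<close>, so the components form
  an orthogonal decomposition. Unordered summation over the integers permits the later shift of the
  index.\<close>

lemma has_sum_component:
  "((\<lambda>z. cinner (component z f) (component z g)) has_sum cinner f g) UNIV"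
proof -
  let ?h = "\<lambda>p. cinner (Rep_l2 f (graded_index p)) (Rep_l2 g (graded_index p))"
  have "(?h has_sum cinner f g) (UNIV \<times> UNIV)"
    unfolding cinner_l2.rep_eq using has_sum_l2inner[OF Rep_l2 Rep_l2]
      has_sum_reindex_bij_betw[OF bij_graded_index, of "\<lambda>n. cinner (Rep_l2 f n) (Rep_l2 g n)"]
    by simp
  then show ?thesis
  proof (rule has_sum_Sigma')
    fix z
    show "((\<lambda>n. ?h (z, n)) has_sum cinner (component z f) (component z g)) UNIV"
      using has_sum_l2inner[OF Rep_l2 Rep_l2, of "component z f" "component z g"]
      by (simp add: cinner_l2.rep_eq component.rep_eq)
  qed
qed

lemma has_sum_norm_component: "((\<lambda>z. (norm (component z f))\<^sup>2) has_sum (norm f)\<^sup>2) UNIV"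
  unfolding norm_sq_cinner by (rule has_sum_Re[OF has_sum_component])

section \<open>Families indexed by the integers\<close>

definition sq_summable :: "(int \<Rightarrow> 'a::complex_inner) \<Rightarrow> bool" where
  "sq_summable h \<longleftrightarrow> (\<lambda>z. (norm (h z))\<^sup>2) summable_on UNIV"

text \<open>The inverse of taking components. \<open>Abs_l2\<close> is meaningful only on
  \<open>l2set\<close>, hence the square-summability condition in
  \<open>component_assemble\<close>.\<close>

definition assemble :: "(int \<Rightarrow> 'a::complex_inner l2) \<Rightarrow> 'a l2" where
  "assemble h = Abs_l2 (\<lambda>m. case inv graded_index m of (z, n) \<Rightarrow> Rep_l2 (h z) n)"

lemma component_assemble:
  assumes "sq_summable h"
  shows "component z (assemble h) = h z"
proof -
  have inv: "inv graded_index (graded_index p) = p" for p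
    by (simp add: bij_is_inj[OF bij_graded_index])
  let ?F = "\<lambda>m. case inv graded_index m of (z, n) \<Rightarrow> Rep_l2 (h z) n"
  have "(\<lambda>p. (norm (case p of (z, n) \<Rightarrow> Rep_l2 (h z) n))\<^sup>2) summable_on (UNIV \<times> UNIV)"
  proof (rule summable_on_SigmaI)
    show "((\<lambda>n. (norm (case (z, n) of (z, n) \<Rightarrow> Rep_l2 (h z) n))\<^sup>2) has_sum (norm (h z))\<^sup>2) UNIV" for z
    proof -
      have "((\<lambda>n. Re (cinner (Rep_l2 (h z) n) (Rep_l2 (h z) n))) has_sum Re (cinner (h z) (h z))) UNIV"
        unfolding cinner_l2.rep_eq by (intro has_sum_Re has_sum_l2inner Rep_l2)
      then show ?thesis by (simp add: norm_sq_cinner)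
    qed
  qed (use assms in \<open>simp_all add: sq_summable_def\<close>)
  then have "?F \<in> l2set" by (simp add: l2set_graded_iff inv)
  then have "Rep_l2 (assemble h) = ?F" by (simp add: assemble_def Abs_l2_inverse)
  then show ?thesis
    by (intro iffD1[OF Rep_l2_inject]) (simp add: component.rep_eq inv fun_eq_iff)
qed

lemma sq_summable_component: "sq_summable (\<lambda>z. component z f)"
  unfolding sq_summable_def using has_sum_norm_component by (rule has_sum_imp_summable)

lemma sq_summable_le:
  assumes "sq_summable g" and "\<And>z. norm (h z) \<le> norm (g z)"
  shows "sq_summable h"
  using assms unfolding sq_summable_def
  by (elim summable_on_comparison_test) (auto intro: power_mono)

text \<open>Aimed at the Schaeffer operators, which differ from a bilateral shift in two degrees
  only.\<close>

lemma sq_summable_finite_change: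
  assumes g: "sq_summable g" and F: "finite F" "\<And>z. z \<notin> F \<Longrightarrow> h z = g z"
  shows "sq_summable h"
proof -
  have "(\<lambda>z. (norm (h z))\<^sup>2 - (norm (g z))\<^sup>2) summable_on UNIV"
    by (rule has_sum_imp_summable[OF has_sum_finite_neutralI[of F]]) (use F in auto)
  from summable_on_add[OF this g[unfolded sq_summable_def]]
  show ?thesis by (simp add: sq_summable_def)
qed

lemma sq_summable_shift:
  assumes "sq_summable g"
  shows "sq_summable (\<lambda>z. g (z + c))"
proof -
  have "bij (\<lambda>z::int. z + c)" by (rule bij_plus_right)
  from summable_on_reindex_bij_betw[OF this, of "\<lambda>z. (norm (g z))\<^sup>2"]
  show ?thesis using assms by (simp add: sq_summable_def)
qed

definition embed_zero :: "'a::complex_inner l2 \<Rightarrow> 'a l2" where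
  "embed_zero x = assemble (\<lambda>z. if z = 0 then x else 0)"

lemma component_embed_zero: "component z (embed_zero x) = (if z = 0 then x else 0)"
  unfolding embed_zero_def
  by (subst component_assemble, rule sq_summable_finite_change[of "\<lambda>z. 0" "{0}"])
    (auto simp: sq_summable_def)

text \<open>This identifies \<open>component 0\<close> as the adjoint of \<open>embed_zero\<close>:
  compressing to the copy in degree 0 means reading off that component.\<close>

lemma cinner_embed_zero: "cinner f (embed_zero y) = cinner (component 0 f) y"
proof -
  have "((\<lambda>z. cinner (component z f) (component z (embed_zero y))) has_sum cinner (component 0 f) y) UNIV"
    by (rule has_sum_finite_neutralI[of "{0}"]) (auto simp: component_embed_zero)
  then show ?thesis using has_sum_component has_sum_unique by blast
qed

lemma clinear_embed_zero: "clinear embed_zero"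
  unfolding clinear_def
  by (intro conjI allI; rule component_eqI) (simp_all add: component_embed_zero component_add component_scaleC)

subsection \<open>Phased diagonal operators\<close>

definition phase_diag :: "complex \<Rightarrow> ('a::complex_inner l2 \<Rightarrow> 'a l2) \<Rightarrow> 'a l2 \<Rightarrow> 'a l2" where
  "phase_diag w V f = assemble (\<lambda>z. (w powi z) *\<^sub>C V (component z f))"

lemma norm_phase: "cmod w = 1 \<Longrightarrow> norm ((w powi z) *\<^sub>C (x::'a::complex_inner)) = norm x"
  by (simp add: norm_scaleC norm_power_int)

lemma component_phase_diag:
  assumes "cmod w = 1" "contraction V"
  shows "component z (phase_diag w V f) = (w powi z) *\<^sub>C V (component z f)"
  unfolding phase_diag_def
  by (rule component_assemble, rule sq_summable_le[OF sq_summable_component[of f]])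
    (use assms in \<open>simp add: norm_phase contraction_def\<close>)

lemma cnj_power_int: "cnj (w powi z) = cnj w powi z"
  by (simp add: power_int_def)

lemma contraction_phase_diag:
  assumes w: "cmod w = 1" and V: "contraction V"
  shows "contraction (phase_diag w V)"
  unfolding contraction_def
proof (intro conjI allI)
  have lin: "clinear V" using V by (simp add: contraction_def)
  show "clinear (phase_diag w V)"
    unfolding clinear_def
    by (intro conjI allI; rule component_eqI)
      (simp_all add: component_phase_diag[OF w V] component_add component_scaleC clinear_add[OF lin]
        clinear_scaleC[OF lin] scaleC_add_right scaleC_scaleC mult.commute)
  fix f
  have "(norm (phase_diag w V f))\<^sup>2 \<le> (norm f)\<^sup>2"
  proof (rule has_sum_mono[OF has_sum_norm_component has_sum_norm_component])
    show "(norm (component z (phase_diag w V f)))\<^sup>2 \<le> (norm (component z f))\<^sup>2" for z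
      using V by (simp add: component_phase_diag[OF w V] norm_phase[OF w] contraction_def power_mono)
  qed
  then show "norm (phase_diag w V f) \<le> norm f" by simp
qed

lemma cadjoint_phase_diag:
  fixes V :: "'a::chilbert_space l2 \<Rightarrow> 'a l2"
  assumes w: "cmod w = 1" and V: "contraction V"
  shows "cadjoint (phase_diag w V) = phase_diag (cnj w) (cadjoint V)"
proof (rule cadjoint_eq)
  show "adjoint_pair (phase_diag w V) (phase_diag (cnj w) (cadjoint V))"
    unfolding adjoint_pair_def
  proof (intro allI)
    fix f g
    have w': "cmod (cnj w) = 1" using w by simp
    have "cinner (component z (phase_diag w V f)) (component z g)
        = cinner (component z f) (component z (phase_diag (cnj w) (cadjoint V) g))" for z
      by (simp add: component_phase_diag[OF w V] component_phase_diag[OF w' contraction_cadjoint[OF V]]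
          cinner_scaleC_left cinner_scaleC_right cnj_power_int adjoint_pairD[OF contraction_adjoint_pair[OF V]])
    then show "cinner (phase_diag w V f) g = cinner f (phase_diag (cnj w) (cadjoint V) g)"
      using has_sum_component[of "phase_diag w V f" g]
        has_sum_component[of f "phase_diag (cnj w) (cadjoint V) g"] has_sum_unique by auto
  qed
qed

subsection \<open>The Schaeffer dilation\<close>

text \<open>A bilateral shift lowering degrees by one, except that degrees 0 and 1 are sent to
  degrees 0 and -1 by the Halmos block: W and minus its adjoint on the diagonal, the two defect
  operators off it. Every degree carries the full space rather than a defect space.\<close>

definition schaeffer :: "('a::chilbert_space l2 \<Rightarrow> 'a l2) \<Rightarrow> 'a l2 \<Rightarrow> 'a l2" where
  "schaeffer W f = assemble (\<lambda>z.
     if z = 0 then W (component 0 f) + defect (\<lambda>x. W (cadjoint W x)) (component 1 f)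
     else if z = -1 then defect (\<lambda>x. cadjoint W (W x)) (component 0 f) - cadjoint W (component 1 f)
     else component (z + 1) f)"

definition schaeffer_adj :: "('a::chilbert_space l2 \<Rightarrow> 'a l2) \<Rightarrow> 'a l2 \<Rightarrow> 'a l2" where
  "schaeffer_adj W f = assemble (\<lambda>z.
     if z = 0 then cadjoint W (component 0 f) + defect (\<lambda>x. cadjoint W (W x)) (component (-1) f)
     else if z = 1 then defect (\<lambda>x. W (cadjoint W x)) (component 0 f) - W (component (-1) f)
     else component (z - 1) f)"

lemma component_schaeffer: "component z (schaeffer W f) =
     (if z = 0 then W (component 0 f) + defect (\<lambda>x. W (cadjoint W x)) (component 1 f)
     else if z = -1 then defect (\<lambda>x. cadjoint W (W x)) (component 0 f) - cadjoint W (component 1 f)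
     else component (z + 1) f)"
  unfolding schaeffer_def
  by (rule component_assemble,
      rule sq_summable_finite_change[OF sq_summable_shift[OF sq_summable_component[of f], of 1], of "{0, -1}"]) auto

lemma component_schaeffer_adj: "component z (schaeffer_adj W f) =
     (if z = 0 then cadjoint W (component 0 f) + defect (\<lambda>x. cadjoint W (W x)) (component (-1) f)
     else if z = 1 then defect (\<lambda>x. W (cadjoint W x)) (component 0 f) - W (component (-1) f)
     else component (z - 1) f)"
  unfolding schaeffer_adj_def
  by (rule component_assemble,
      rule sq_summable_finite_change[OF sq_summable_shift[OF sq_summable_component[of f], of "-1"], of "{0, 1}"]) auto

context
  fixes W :: "'a::chilbert_space l2 \<Rightarrow> 'a l2"
  assumes W: "contraction W"
begin

private lemma WW: "contraction (\<lambda>x. cadjoint W (W x))" "contraction (\<lambda>x. W (cadjoint W x))"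
  by (rule contraction_compose[OF contraction_cadjoint[OF W] W],
      rule contraction_compose[OF W contraction_cadjoint[OF W]])

private lemma W_pair: "adjoint_pair W (cadjoint W)" "adjoint_pair (cadjoint W) W"
  by (rule contraction_adjoint_pair[OF W], rule adjoint_pair_sym[OF contraction_adjoint_pair[OF W]])

private lemma defect_pair:
  "adjoint_pair (defect (\<lambda>x. cadjoint W (W x))) (defect (\<lambda>x. cadjoint W (W x)))"
  "adjoint_pair (defect (\<lambda>x. W (cadjoint W x))) (defect (\<lambda>x. W (cadjoint W x)))"
  by (rule defect_selfadjoint[OF WW(1) adjoint_pair_compose[OF W_pair(2) W_pair(1)]],
      rule defect_selfadjoint[OF WW(2) adjoint_pair_compose[OF W_pair(1) W_pair(2)]])

text \<open>These relations cancel the off-diagonal entries when the Halmos block is multiplied by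
  its adjoint on either side; the diagonal entries are settled by
  \<open>defect_square\<close>.\<close>

private lemma defect_swap:
  "W (defect (\<lambda>x. cadjoint W (W x)) x) = defect (\<lambda>x. W (cadjoint W x)) (W x)"
  "cadjoint W (defect (\<lambda>x. W (cadjoint W x)) x) = defect (\<lambda>x. cadjoint W (W x)) (cadjoint W x)"
  by (rule defect_intertwine; simp add: WW contraction_bounded_linear contraction_cadjoint W)+

private lemma clinears:
  "clinear W" "clinear (cadjoint W)"
  "clinear (defect (\<lambda>x. cadjoint W (W x)))" "clinear (defect (\<lambda>x. W (cadjoint W x)))"
  by (rule W_pair[THEN adjoint_pair_clinear] defect_pair[THEN adjoint_pair_clinear])+

private lemmas linear_simps = clinears[THEN clinear_add] clinears[THEN clinear_diff]
  clinears[THEN clinear_scaleC]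

lemma schaeffer_adj_schaeffer: "schaeffer_adj W (schaeffer W f) = f"
proof (rule component_eqI)
  fix z
  show "component z (schaeffer_adj W (schaeffer W f)) = component z f"
    by (simp add: component_schaeffer_adj component_schaeffer linear_simps
        defect_square WW defect_swap)
qed

lemma schaeffer_schaeffer_adj: "schaeffer W (schaeffer_adj W f) = f"
proof (rule component_eqI)
  fix z
  show "component z (schaeffer W (schaeffer_adj W f)) = component z f"
    by (simp add: component_schaeffer_adj component_schaeffer linear_simps
        defect_square WW defect_swap)
qed

text \<open>After one of the two sums is shifted by 1, their terms agree outside degrees 0 and -1.
  The two remaining terms cancel by the adjoint relations among the block entries.\<close>

lemma adjoint_pair_schaeffer: "adjoint_pair (schaeffer W) (schaeffer_adj W)"
  unfolding adjoint_pair_def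
proof (intro allI)
  fix f g
  let ?a = "\<lambda>z. cinner (component z (schaeffer W f)) (component z g)"
  let ?b = "\<lambda>z. cinner (component z f) (component z (schaeffer_adj W g))"
  have "(?b has_sum cinner f (schaeffer_adj W g)) UNIV" by (rule has_sum_component)
  then have "((\<lambda>z. ?b (z + 1)) has_sum cinner f (schaeffer_adj W g)) UNIV"
    by (subst has_sum_reindex_bij_betw[OF bij_plus_right])
  then have "((\<lambda>z. - ?b (z + 1)) has_sum - cinner f (schaeffer_adj W g)) UNIV"
    by (simp add: has_sum_uminus)
  from has_sum_add[OF has_sum_component[of "schaeffer W f" g] this]
  have "((\<lambda>z. ?a z - ?b (z + 1)) has_sum (cinner (schaeffer W f) g - cinner f (schaeffer_adj W g))) UNIV"
    by simp
  moreover have "((\<lambda>z. ?a z - ?b (z + 1)) has_sum 0) UNIV"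
  proof (rule has_sum_finite_neutralI[of "{0, -1}"])
    show "0 = (\<Sum>z\<in>{0, -1}. ?a z - ?b (z + 1))"
      by (simp add: component_schaeffer component_schaeffer_adj cinner_add_left cinner_diff_left
          cinner_add_right cinner_diff_right adjoint_pairD[OF W_pair(1)] adjoint_pairD[OF W_pair(2)]
          adjoint_pairD[OF defect_pair(1)] adjoint_pairD[OF defect_pair(2)])
  qed (auto simp: component_schaeffer component_schaeffer_adj)
  ultimately show "cinner (schaeffer W f) g = cinner f (schaeffer_adj W g)"
    using has_sum_unique by fastforce
qed

lemma cadjoint_schaeffer: "cadjoint (schaeffer W) = schaeffer_adj W"
  by (rule cadjoint_eq[OF adjoint_pair_schaeffer])

lemma contraction_schaeffer: "contraction (schaeffer W)"
  unfolding contraction_def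
proof (intro conjI allI)
  show "clinear (schaeffer W)" by (rule adjoint_pair_clinear[OF adjoint_pair_schaeffer])
  show "norm (schaeffer W f) \<le> norm f" for f
    using adjoint_pairD[OF adjoint_pair_schaeffer, of f "schaeffer W f"]
    by (simp add: schaeffer_adj_schaeffer norm_eq_sqrt_cinner)
qed

text \<open>In degree \<open>z\<close> the shift delivers \<open>w powi (z + 1)\<close>, one factor
  \<open>w\<close> more than the diagonal has there. In the block, \<open>W\<close> produces this
  factor itself in degree 0, while in degree -1 the \<open>cnj w\<close> from
  \<open>cadjoint W\<close> cancels the phase of degree 1; the defect operators commute with
  \<open>V\<close>.\<close>

lemma schaeffer_phase_diag:
  assumes w: "cmod w = 1" and V: "contraction V"
    and comm: "\<And>x. W (V x) = w *\<^sub>C V (W x)" "\<And>x. cadjoint W (V x) = cnj w *\<^sub>C V (cadjoint W x)"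
  shows "schaeffer W (phase_diag w V f) = w *\<^sub>C phase_diag w V (schaeffer W f)"
proof (rule component_eqI)
  fix z
  have lin: "clinear V" using V by (simp add: contraction_def)
  have ww: "w * cnj w = 1" "cnj w * w = 1" using w by (simp_all add: complex_norm_square[symmetric] mult.commute)
  have w0: "w \<noteq> 0" using w by auto
  \<comment> \<open>Moving \<open>V\<close> past \<open>W\<close> and past \<open>cadjoint W\<close>
    yields \<open>w\<close> and \<open>cnj w\<close>, which cancel in both products.\<close>
  have D: "defect (\<lambda>x. cadjoint W (W x)) (V x) = V (defect (\<lambda>x. cadjoint W (W x)) x)"
    "defect (\<lambda>x. W (cadjoint W x)) (V x) = V (defect (\<lambda>x. W (cadjoint W x)) x)" for x
    by (rule defect_intertwine[symmetric]; simp add: WW contraction_bounded_linear V comm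
        linear_simps scaleC_scaleC ww)+
  show "component z (schaeffer W (phase_diag w V f)) = component z (w *\<^sub>C phase_diag w V (schaeffer W f))"
    by (simp add: component_schaeffer component_phase_diag[OF w V] component_scaleC linear_simps D comm
        clinear_add[OF lin] clinear_diff[OF lin] scaleC_add_right scaleC_diff_right scaleC_scaleC ww
        power_int_minus w0 power_int_add mult.commute)
qed

text \<open>A vector starting in degree 0 never reaches positive degrees. Degree 1, the only other
  input of degree 0, stays empty, so just \<open>W\<close> acts there. For the adjoint the picture
  is reflected.\<close>

lemma schaeffer_funpow:
  "z > 0 \<Longrightarrow> component z ((schaeffer W ^^ n) (embed_zero x)) = 0"
  "component 0 ((schaeffer W ^^ n) (embed_zero x)) = (W ^^ n) x"
  by (induction n arbitrary: z) (simp_all add: component_embed_zero component_schaeffer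
      clinears[THEN clinear_0])

lemma schaeffer_adj_funpow:
  "z < 0 \<Longrightarrow> component z ((schaeffer_adj W ^^ n) (embed_zero x)) = 0"
  "component 0 ((schaeffer_adj W ^^ n) (embed_zero x)) = (cadjoint W ^^ n) x"
  by (induction n arbitrary: z) (simp_all add: component_embed_zero component_schaeffer_adj
      clinears[THEN clinear_0])

lemma component_op_pow_schaeffer:
  "component 0 (op_pow (schaeffer W) m (embed_zero x)) = op_pow W m x"
  by (simp add: op_pow_def cadjoint_schaeffer schaeffer_funpow schaeffer_adj_funpow)

end

subsection \<open>Dilating one operator of the tuple\<close>

definition unitary_op :: "('a::complex_inner \<Rightarrow> 'a) \<Rightarrow> bool" where
  "unitary_op U \<longleftrightarrow> (\<forall>x. U (cadjoint U x) = x) \<and> (\<forall>x. cadjoint U (U x) = x)"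

text \<open>\<open>Q\<close> is a full matrix over ordered pairs, so that the operator to be dilated
  may stand before or after the other one.\<close>

definition doubly_commuting ::
    "nat \<Rightarrow> (nat \<Rightarrow> nat \<Rightarrow> complex) \<Rightarrow> (nat \<Rightarrow> 'a::complex_inner \<Rightarrow> 'a) \<Rightarrow> bool" where
  "doubly_commuting k Q V \<longleftrightarrow> (\<forall>i\<in>{1..k}. contraction (V i)) \<and>
     (\<forall>i\<in>{1..k}. \<forall>j\<in>{1..k}. i \<noteq> j \<longrightarrow>
        (\<forall>x. V i (V j x) = Q i j *\<^sub>C V j (V i x)) \<and>
        (\<forall>x. V i (cadjoint (V j) x) = cnj (Q i j) *\<^sub>C cadjoint (V j) (V i x)))"

lemma doubly_commutingD:
  assumes "doubly_commuting k Q V"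
  shows "i \<in> {1..k} \<Longrightarrow> contraction (V i)"
    and "i \<in> {1..k} \<Longrightarrow> j \<in> {1..k} \<Longrightarrow> i \<noteq> j \<Longrightarrow> V i (V j x) = Q i j *\<^sub>C V j (V i x)"
    and "i \<in> {1..k} \<Longrightarrow> j \<in> {1..k} \<Longrightarrow> i \<noteq> j \<Longrightarrow>
      V i (cadjoint (V j) x) = cnj (Q i j) *\<^sub>C cadjoint (V j) (V i x)"
  using assms unfolding doubly_commuting_def by blast+

text \<open>Compression expressed by matrix coefficients, a form that is transitive under
  composition of the embeddings. It becomes a projection only in
  \<open>l2proj_range\<close>.\<close>

definition weak_dilation ::
    "nat \<Rightarrow> (nat \<Rightarrow> 'b::complex_inner \<Rightarrow> 'b) \<Rightarrow> ('a::complex_inner \<Rightarrow> 'b) \<Rightarrow> (nat \<Rightarrow> 'a \<Rightarrow> 'a) \<Rightarrow> bool" where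
  "weak_dilation k V J T \<longleftrightarrow> (\<forall>m x y.
     cinner (ordered_prod (\<lambda>i. op_pow (V i) (m i)) k (J x)) (J y)
       = cinner (ordered_prod (\<lambda>i. op_pow (T i) (m i)) k x) y)"

lemma weak_dilation_trans:
  "weak_dilation k V J T \<Longrightarrow> weak_dilation k V' J' V \<Longrightarrow> weak_dilation k V' (\<lambda>x. J' (J x)) T"
  by (simp add: weak_dilation_def)

lemma op_pow_commute_map:
  assumes "\<And>x. \<phi> (A x) = B (\<phi> x)" "\<And>x. \<phi> (cadjoint A x) = cadjoint B (\<phi> x)"
  shows "\<phi> (op_pow A m x) = op_pow B m (\<phi> x)"
proof -
  have "\<phi> ((A ^^ n) x) = (B ^^ n) (\<phi> x)" "\<phi> ((cadjoint A ^^ n) x) = (cadjoint B ^^ n) (\<phi> x)" for n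
    by (induction n) (simp_all add: assms)
  then show ?thesis by (simp add: op_pow_def)
qed

lemma ordered_prod_commute_map:
  assumes "\<And>i x. i \<in> {1..n} \<Longrightarrow> \<phi> (F i x) = G i (\<phi> x)"
  shows "\<phi> (ordered_prod F n x) = ordered_prod G n (\<phi> x)"
  using assms by (induction n arbitrary: x) simp_all

lemma unit_cnj: "cmod w = 1 \<Longrightarrow> w * cnj w = 1" "cmod w = 1 \<Longrightarrow> cnj w * w = 1"
  by (simp_all add: complex_norm_square[symmetric] mult.commute)

lemma twisted_commute_swap:
  assumes "cmod w = 1" "a = w *\<^sub>C b"
  shows "b = cnj w *\<^sub>C (a::'a::complex_inner)"
  using assms by (simp add: scaleC_scaleC unit_cnj)

text \<open>Inserting \<open>cadjoint U\<close> after \<open>U\<close> on the left and cancelling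
  moves \<open>cadjoint U\<close> past \<open>D\<close>; taking adjoints of the result gives the
  second relation.\<close>

lemma unitary_twisted_commute:
  fixes U D :: "'a::chilbert_space \<Rightarrow> 'a"
  assumes U: "contraction U" "unitary_op U" and D: "contraction D"
    and comm: "\<And>x. U (D x) = w *\<^sub>C D (U x)"
  shows "D (cadjoint U x) = w *\<^sub>C cadjoint U (D x)" "U (cadjoint D x) = cnj w *\<^sub>C cadjoint D (U x)"
proof -
  have lin: "clinear (cadjoint U)" using contraction_cadjoint[OF U(1)] by (simp add: contraction_def)
  show 1: "D (cadjoint U x) = w *\<^sub>C cadjoint U (D x)" for x
  proof -
    have "D (cadjoint U x) = cadjoint U (U (D (cadjoint U x)))" using U by (simp add: unitary_op_def)
    also have "\<dots> = w *\<^sub>C cadjoint U (D x)"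
      using U(2) by (simp add: comm clinear_scaleC[OF lin] unitary_op_def)
    finally show ?thesis .
  qed
  show "U (cadjoint D x) = cnj w *\<^sub>C cadjoint D (U x)"
    by (rule cadjoint_twisted_commute[OF contraction_adjoint_pair[OF D]
          adjoint_pair_sym[OF contraction_adjoint_pair[OF U(1)]] 1])
qed

context
  fixes k :: nat and Q :: "nat \<Rightarrow> nat \<Rightarrow> complex" and V :: "nat \<Rightarrow> 'a::chilbert_space l2 \<Rightarrow> 'a l2" and p :: nat
  assumes V: "doubly_commuting k Q V" and p: "p \<in> {1..k}"
    and Q_unit: "\<And>i j. i \<in> {1..k} \<Longrightarrow> j \<in> {1..k} \<Longrightarrow> cmod (Q i j) = 1"
    and Q_sym: "\<And>i j. Q j i = cnj (Q i j)"
begin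

definition dilate_at :: "nat \<Rightarrow> 'a l2 \<Rightarrow> 'a l2" where
  "dilate_at i = (if i = p then schaeffer (V p) else phase_diag (Q p i) (V i))"

private lemmas contr = doubly_commutingD(1)[OF V]
  and comm = doubly_commutingD(2)[OF V]
  and comm_adj = doubly_commutingD(3)[OF V]

private lemma lin: "i \<in> {1..k} \<Longrightarrow> clinear (V i)" "i \<in> {1..k} \<Longrightarrow> clinear (cadjoint (V i))"
  using contr contraction_cadjoint[OF contr] by (simp_all add: contraction_def)

private lemma Q_unit': "i \<in> {1..k} \<Longrightarrow> j \<in> {1..k} \<Longrightarrow> cmod (cnj (Q i j)) = 1"
  using Q_unit by simp

private lemma contr': "i \<in> {1..k} \<Longrightarrow> contraction (dilate_at i)"
  using p by (simp add: dilate_at_def contraction_schaeffer contraction_phase_diag contr Q_unit)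

lemma unitary_dilate_at: "unitary_op (dilate_at p)"
  by (simp add: dilate_at_def unitary_op_def cadjoint_schaeffer[OF contr[OF p]]
      schaeffer_adj_schaeffer[OF contr[OF p]] schaeffer_schaeffer_adj[OF contr[OF p]])

lemma unitary_dilate_at':
  assumes i: "i \<in> {1..k}" "i \<noteq> p" and U: "unitary_op (V i)"
  shows "unitary_op (dilate_at i)"
  unfolding unitary_op_def
proof (intro conjI allI; rule component_eqI)
  fix x z
  note [simp] = component_phase_diag[OF Q_unit[OF p i(1)] contr[OF i(1)]]
    component_phase_diag[OF Q_unit'[OF p i(1)] contraction_cadjoint[OF contr[OF i(1)]]]
    cadjoint_phase_diag[OF Q_unit[OF p i(1)] contr[OF i(1)]]
  have phase: "Q p i powi z * cnj (Q p i) powi z = 1" "cnj (Q p i) powi z * Q p i powi z = 1"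
    by (simp_all add: Q_unit[OF p i(1)] unit_cnj flip: power_int_mult_distrib)
  show "component z (dilate_at i (cadjoint (dilate_at i) x)) = component z x"
    "component z (cadjoint (dilate_at i) (dilate_at i x)) = component z x"
    using U i by (simp_all add: dilate_at_def clinear_scaleC[OF lin(1)] clinear_scaleC[OF lin(2)]
        scaleC_scaleC phase unitary_op_def)
qed

private lemma twist:
  assumes j: "j \<in> {1..k}" "j \<noteq> p"
  shows "dilate_at p (dilate_at j x) = Q p j *\<^sub>C dilate_at j (dilate_at p x)"
proof -
  \<comment> \<open>The hypothesis for the pair \<open>j\<close>, \<open>p\<close> solved for its
    other side, with \<open>Q j p = cnj (Q p j)\<close>.\<close>
  have "cadjoint (V p) (V j x) = cnj (Q p j) *\<^sub>C V j (cadjoint (V p) x)" for x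
    by (rule twisted_commute_swap) (use comm_adj[OF j(1) p j(2)] Q_sym[of p j] Q_unit p j in simp_all)
  then show ?thesis
    using j schaeffer_phase_diag[OF contr[OF p] Q_unit[OF p j(1)] contr[OF j(1)] comm[OF p j(1)]]
    by (simp add: dilate_at_def)
qed

text \<open>For pairs containing \<open>p\<close>, \<open>twist\<close> suffices because
  \<open>dilate_at p\<close> is unitary. Two phased diagonals inherit the relations of
  \<open>V\<close> degree by degree, their phases being scalars.\<close>

lemma doubly_commuting_dilate_at: "doubly_commuting k Q dilate_at"
  unfolding doubly_commuting_def
proof (intro conjI ballI impI allI)
  fix i j x assume i: "i \<in> {1..k}" and j: "j \<in> {1..k}" and ij: "i \<noteq> j"
  consider "i = p" "j \<noteq> p" | "i \<noteq> p" "j = p" | "i \<noteq> p" "j \<noteq> p" using ij by blast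
  then have "dilate_at i (dilate_at j x) = Q i j *\<^sub>C dilate_at j (dilate_at i x) \<and>
    dilate_at i (cadjoint (dilate_at j) x) = cnj (Q i j) *\<^sub>C cadjoint (dilate_at j) (dilate_at i x)"
  proof cases
    case 1
    then show ?thesis
      using twist[OF j] unitary_twisted_commute(2)[OF contr'[OF p] unitary_dilate_at contr'[OF j] twist[OF j]]
      by simp
  next
    case 2
    have "dilate_at i (dilate_at p x) = cnj (Q p i) *\<^sub>C dilate_at p (dilate_at i x)"
      by (rule twisted_commute_swap[OF Q_unit[OF p i] twist[OF i 2(1)]])
    then show ?thesis
      using unitary_twisted_commute(1)[OF contr'[OF p] unitary_dilate_at contr'[OF i] twist[OF i 2(1)]]
        2 Q_sym[of p i] by simp
  next
    case 3
    note [simp] = component_phase_diag[OF Q_unit[OF p i] contr[OF i]]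
      component_phase_diag[OF Q_unit[OF p j] contr[OF j]]
      component_phase_diag[OF Q_unit'[OF p j] contraction_cadjoint[OF contr[OF j]]]
      cadjoint_phase_diag[OF Q_unit[OF p j] contr[OF j]]
    have "dilate_at i (dilate_at j x) = Q i j *\<^sub>C dilate_at j (dilate_at i x)"
      by (rule component_eqI)
        (use 3 in \<open>simp add: dilate_at_def component_scaleC clinear_scaleC[OF lin(1)[OF i]]
          clinear_scaleC[OF lin(1)[OF j]] scaleC_scaleC comm[OF i j ij] mult_ac\<close>)
    moreover have "dilate_at i (cadjoint (dilate_at j) x) = cnj (Q i j) *\<^sub>C cadjoint (dilate_at j) (dilate_at i x)"
      by (rule component_eqI)
        (use 3 in \<open>simp add: dilate_at_def component_scaleC clinear_scaleC[OF lin(1)[OF i]]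
          clinear_scaleC[OF lin(2)[OF j]] scaleC_scaleC comm_adj[OF i j ij] mult_ac\<close>)
    ultimately show ?thesis by blast
  qed
  then show "dilate_at i (dilate_at j x) = Q i j *\<^sub>C dilate_at j (dilate_at i x)"
    "dilate_at i (cadjoint (dilate_at j) x) = cnj (Q i j) *\<^sub>C cadjoint (dilate_at j) (dilate_at i x)"
    by blast+
qed (rule contr')

text \<open>In degree 0 the phase is \<open>w powi 0 = 1\<close>. This lemma and the next say that
  the copy in degree 0 reduces the diagonal operators, for negative powers as well.\<close>

private lemma component_op_pow:
  assumes i: "i \<in> {1..k}" "i \<noteq> p"
  shows "component 0 (op_pow (dilate_at i) m f) = op_pow (V i) m (component 0 f)"
  by (rule op_pow_commute_map)
    (use i in \<open>simp_all add: dilate_at_def cadjoint_phase_diag[OF Q_unit[OF p i(1)] contr[OF i(1)]]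
      component_phase_diag[OF Q_unit[OF p i(1)] contr[OF i(1)]]
      component_phase_diag[OF Q_unit'[OF p i(1)] contraction_cadjoint[OF contr[OF i(1)]]]\<close>)

private lemma op_pow_embed_zero:
  assumes i: "i \<in> {1..k}" "i \<noteq> p"
  shows "op_pow (dilate_at i) m (embed_zero x) = embed_zero (op_pow (V i) m x)"
proof (rule op_pow_commute_map[symmetric]; rule component_eqI)
  fix x z
  show "component z (embed_zero (V i x)) = component z (dilate_at i (embed_zero x))"
    "component z (embed_zero (cadjoint (V i) x)) = component z (cadjoint (dilate_at i) (embed_zero x))"
    using i by (simp_all add: dilate_at_def cadjoint_phase_diag[OF Q_unit[OF p i(1)] contr[OF i(1)]]
      component_phase_diag[OF Q_unit[OF p i(1)] contr[OF i(1)]]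
      component_phase_diag[OF Q_unit'[OF p i(1)] contraction_cadjoint[OF contr[OF i(1)]]]
      component_embed_zero clinear_0[OF lin(1)] clinear_0[OF lin(2)])
qed

text \<open>Factors to the right of position \<open>p\<close> act first and stay inside the embedded
  copy. The factor at \<open>p\<close> leaves it but has the right component 0, and the factors
  further left commute with \<open>component 0\<close>.\<close>

lemma weak_dilation_dilate_at: "weak_dilation k dilate_at embed_zero V"
proof -
  have "component 0 (ordered_prod (\<lambda>i. op_pow (dilate_at i) (m i)) n (embed_zero x))
      = ordered_prod (\<lambda>i. op_pow (V i) (m i)) n x" if "n \<le> k" for m n x
    using that
  proof (induction n arbitrary: x)
    case 0
    then show ?case by (simp add: component_embed_zero)
  next
    case (Suc n)
    show ?case
    proof (cases "Suc n = p")
      case False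
      have "Suc n \<in> {1..k}" using Suc.prems by simp
      then show ?thesis using Suc False by (simp add: op_pow_embed_zero)
    next
      case True
      have "component 0 (ordered_prod (\<lambda>i. op_pow (dilate_at i) (m i)) n f)
          = ordered_prod (\<lambda>i. op_pow (V i) (m i)) n (component 0 f)" for f
        by (rule ordered_prod_commute_map) (use True Suc.prems in \<open>simp add: component_op_pow\<close>)
      moreover have "component 0 (op_pow (dilate_at p) (m p) (embed_zero x)) = op_pow (V p) (m p) x"
        by (simp add: dilate_at_def component_op_pow_schaeffer[OF contr[OF p]])
      ultimately show ?thesis
        unfolding ordered_prod.simps by (simp add: True)
    qed
  qed
  then show ?thesis by (simp add: weak_dilation_def cinner_embed_zero)
qed

end

subsection \<open>Amplification\<close>

definition amplify :: "('a::complex_inner \<Rightarrow> 'a) \<Rightarrow> 'a l2 \<Rightarrow> 'a l2" where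
  "amplify A f = Abs_l2 (\<lambda>n. A (Rep_l2 f n))"

lemma l2_eqI: "(\<And>n. Rep_l2 f n = Rep_l2 g n) \<Longrightarrow> f = g"
  by (metis Rep_l2_inject ext)

lemma Rep_amplify:
  assumes "contraction A"
  shows "Rep_l2 (amplify A f) n = A (Rep_l2 f n)"
proof -
  have "(\<lambda>n. A (Rep_l2 f n)) \<in> l2set"
    unfolding l2set_iff
    by (rule summable_comparison_test'[OF Rep_l2_summable[of f]])
      (use assms in \<open>simp add: contraction_def power_mono\<close>)
  then show ?thesis by (simp add: amplify_def Abs_l2_inverse)
qed

lemma contraction_amplify:
  assumes A: "contraction A"
  shows "contraction (amplify A)"
  unfolding contraction_def
proof (intro conjI allI)
  have lin: "clinear A" using A by (simp add: contraction_def)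
  show "clinear (amplify A)"
    unfolding clinear_def
    by (intro conjI allI; rule l2_eqI)
      (simp_all add: Rep_amplify[OF A] plus_l2.rep_eq scaleC_l2.rep_eq clinear_add[OF lin] clinear_scaleC[OF lin])
  show "norm (amplify A f) \<le> norm f" for f
  proof -
    have "(norm (amplify A f))\<^sup>2 \<le> (norm f)\<^sup>2"
      unfolding norm_l2_sq
      by (rule suminf_le[OF _ Rep_l2_summable Rep_l2_summable])
        (use A in \<open>simp add: Rep_amplify contraction_def power_mono\<close>)
    then show ?thesis by simp
  qed
qed

lemma cadjoint_amplify:
  fixes A :: "'a::chilbert_space \<Rightarrow> 'a"
  assumes A: "contraction A"
  shows "cadjoint (amplify A) = amplify (cadjoint A)"
  by (rule cadjoint_eq)
    (simp add: adjoint_pair_def cinner_l2.rep_eq l2inner_def Rep_amplify A contraction_cadjoint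
      adjoint_pairD[OF contraction_adjoint_pair[OF A]])

lemma doubly_commuting_amplify:
  fixes T :: "nat \<Rightarrow> 'a::chilbert_space \<Rightarrow> 'a"
  assumes "doubly_commuting k Q T"
  shows "doubly_commuting k Q (\<lambda>i. amplify (T i))"
  unfolding doubly_commuting_def
proof (intro conjI ballI impI allI)
  show "contraction (amplify (T i))" if "i \<in> {1..k}" for i 
    by (rule contraction_amplify[OF doubly_commutingD(1)[OF assms that]])
  fix i j x assume ij: "i \<in> {1..k}" "j \<in> {1..k}" "i \<noteq> j"
  note T = doubly_commutingD(1)[OF assms ij(1)] doubly_commutingD(1)[OF assms ij(2)]
  note comm = doubly_commutingD(2,3)[OF assms ij]
  show "amplify (T i) (amplify (T j) x) = Q i j *\<^sub>C amplify (T j) (amplify (T i) x)"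
    "amplify (T i) (cadjoint (amplify (T j)) x) = cnj (Q i j) *\<^sub>C cadjoint (amplify (T j)) (amplify (T i) x)"
    by (rule l2_eqI; simp add: cadjoint_amplify Rep_amplify T contraction_cadjoint scaleC_l2.rep_eq comm)+
qed

definition inject_first :: "'a::complex_inner \<Rightarrow> 'a l2" where
  "inject_first x = Abs_l2 (\<lambda>n. if n = 0 then x else 0)"

lemma Rep_inject_first: "Rep_l2 (inject_first x) n = (if n = 0 then x else 0)"
proof -
  have "(\<lambda>n. if n = (0::nat) then x else 0) \<in> l2set"
    unfolding l2set_iff by (rule summable_finite[of "{0}"]) auto
  then show ?thesis by (simp add: inject_first_def Abs_l2_inverse)
qed

lemma clinear_inject_first: "clinear inject_first"
  unfolding clinear_def
  by (intro conjI allI; rule l2_eqI) (simp_all add: Rep_inject_first plus_l2.rep_eq scaleC_l2.rep_eq)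

lemma cinner_inject_first: "cinner (inject_first x) (inject_first y) = cinner x y"
proof -
  have "l2inner (Rep_l2 (inject_first x)) (Rep_l2 (inject_first y))
      = (\<Sum>n\<in>{0}. cinner (Rep_l2 (inject_first x) n) (Rep_l2 (inject_first y) n))"
    unfolding l2inner_def by (rule suminf_finite) (simp_all add: Rep_inject_first)
  then show ?thesis by (simp add: cinner_l2.rep_eq Rep_inject_first)
qed

lemma weak_dilation_amplify:
  fixes T :: "nat \<Rightarrow> 'a::chilbert_space \<Rightarrow> 'a"
  assumes "\<And>i. i \<in> {1..k} \<Longrightarrow> contraction (T i)"
  shows "weak_dilation k (\<lambda>i. amplify (T i)) inject_first T"
proof -
  have inj: "inject_first (A x) = amplify A (inject_first x)" if "contraction A" for A :: "'a \<Rightarrow> 'a" and x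
    by (rule l2_eqI) (use that in \<open>auto simp: Rep_amplify Rep_inject_first contraction_def clinear_0\<close>)
  have prod: "inject_first (ordered_prod (\<lambda>i. op_pow (T i) (m i)) k x)
      = ordered_prod (\<lambda>i. op_pow (amplify (T i)) (m i)) k (inject_first x)" for m x
    by (rule ordered_prod_commute_map, rule op_pow_commute_map)
      (use assms in \<open>simp_all add: inj cadjoint_amplify contraction_cadjoint\<close>)
  show ?thesis by (simp add: weak_dilation_def cinner_inject_first flip: prod)
qed

subsection \<open>The simultaneous dilation\<close>

text \<open>Induction on the number \<open>r\<close> of operators already unitary, starting from the
  amplification. The step dilates at position \<open>Suc r\<close>; phasing preserves the unitarity
  of the earlier ones.\<close>

lemma simultaneous_dilation:
  fixes T :: "nat \<Rightarrow> 'a::chilbert_space \<Rightarrow> 'a"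
  assumes T: "doubly_commuting k Q T"
    and Q_unit: "\<And>i j. i \<in> {1..k} \<Longrightarrow> j \<in> {1..k} \<Longrightarrow> cmod (Q i j) = 1"
    and Q_sym: "\<And>i j. Q j i = cnj (Q i j)"
    and "r \<le> k"
  shows "\<exists>(V :: nat \<Rightarrow> 'a l2 \<Rightarrow> 'a l2) J. doubly_commuting k Q V \<and> (\<forall>i\<in>{1..r}. unitary_op (V i)) \<and>
    clinear J \<and> (\<forall>x y. cinner (J x) (J y) = cinner x y) \<and> weak_dilation k V J T"
  using \<open>r \<le> k\<close>
proof (induction r)
  case 0
  have "weak_dilation k (\<lambda>i. amplify (T i)) inject_first T"
    by (rule weak_dilation_amplify) (rule doubly_commutingD(1)[OF T])
  then show ?case
    using doubly_commuting_amplify[OF T] clinear_inject_first cinner_inject_first by fastforce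
next
  case (Suc r)
  then obtain V :: "nat \<Rightarrow> 'a l2 \<Rightarrow> 'a l2" and J where V: "doubly_commuting k Q V"
    and U: "\<And>i. i \<in> {1..r} \<Longrightarrow> unitary_op (V i)"
    and J: "clinear J" "\<And>x y. cinner (J x) (J y) = cinner x y" and dil: "weak_dilation k V J T"
    by auto
  have p: "Suc r \<in> {1..k}" using Suc.prems by simp
  note step = V p Q_unit Q_sym
  let ?V = "dilate_at Q V (Suc r)"
  have "doubly_commuting k Q ?V" by (rule doubly_commuting_dilate_at[OF step])
  moreover have "unitary_op (?V i)" if "i \<in> {1..Suc r}" for i
  proof (cases "i = Suc r")
    case True
    then show ?thesis using unitary_dilate_at[OF step] by simp
  next
    case False
    then have "i \<in> {1..r}" "i \<in> {1..k}" using that Suc.prems by auto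
    then show ?thesis using unitary_dilate_at'[OF step _ False U] by simp
  qed
  moreover have "clinear (\<lambda>x. embed_zero (J x))"
    unfolding clinear_def
    by (simp add: clinear_add[OF J(1)] clinear_scaleC[OF J(1)] clinear_add[OF clinear_embed_zero]
        clinear_scaleC[OF clinear_embed_zero])
  moreover have "cinner (embed_zero (J x)) (embed_zero (J y)) = cinner x y" for x y
    by (simp add: cinner_embed_zero component_embed_zero J)
  moreover have "weak_dilation k ?V (\<lambda>x. embed_zero (J x)) T"
    by (rule weak_dilation_trans[OF dil weak_dilation_dilate_at[OF step]])
  ultimately show ?case by blast
qed

subsection \<open>Transfer to square-summable functions\<close>

lemma l2_ops_Rep:
  "l2add (Rep_l2 x) (Rep_l2 y) = Rep_l2 (x + y)" "l2diff (Rep_l2 x) (Rep_l2 y) = Rep_l2 (x - y)"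
  "l2scale c (Rep_l2 x) = Rep_l2 (c *\<^sub>C x)" "l2inner (Rep_l2 x) (Rep_l2 y) = cinner x y"
  "l2norm (Rep_l2 x) = norm x"
  by (simp_all add: l2add_def l2diff_def l2scale_def plus_l2.rep_eq minus_l2.rep_eq scaleC_l2.rep_eq
      cinner_l2.rep_eq norm_l2.rep_eq)

lemma l2set_eq_range: "l2set = range Rep_l2"
  by (rule type_definition.Rep_range[OF type_definition_l2, symmetric])

lemma closed_l2_subspace_l2set: "closed_l2_subspace (l2set :: (nat \<Rightarrow> 'a::chilbert_space) set)"
  unfolding closed_l2_subspace_def
proof (intro conjI allI ballI impI subset_refl l2set_zero)
  fix f g :: "nat \<Rightarrow> 'a" and c assume "f \<in> l2set" "g \<in> l2set"
  then show "l2add f g \<in> l2set" by (simp add: l2add_def l2set_add_aux)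
next
  fix f :: "nat \<Rightarrow> 'a" and c assume "f \<in> l2set"
  then show "l2scale c f \<in> l2set" by (simp add: l2scale_def l2set_scaleC)
next
  fix X :: "nat \<Rightarrow> nat \<Rightarrow> 'a"
  assume "\<forall>n. X n \<in> l2set" and cauchy: "\<forall>e>0. \<exists>N. \<forall>m\<ge>N. \<forall>n\<ge>N. l2norm (l2diff (X m) (X n)) < e"
  then have "\<forall>n. \<exists>y. X n = Rep_l2 y" by (auto simp: l2set_eq_range)
  then obtain Y where Y: "\<And>n. X n = Rep_l2 (Y n)" by metis
  have "Cauchy Y" by (rule CauchyI) (use cauchy in \<open>simp add: Y l2_ops_Rep\<close>)
  then obtain y where "Y \<longlonglongrightarrow> y" by (auto simp: Cauchy_convergent_iff convergent_def)
  then have "(\<lambda>n. norm (Y n - y)) \<longlonglongrightarrow> 0"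
    by (simp add: LIM_zero tendsto_norm_zero)
  then show "\<exists>y\<in>l2set. (\<lambda>n. l2norm (l2diff (X n) y)) \<longlonglongrightarrow> 0"
    by (intro bexI[of _ "Rep_l2 y"]) (simp_all add: Y l2_ops_Rep Rep_l2)
qed

definition on_l2set :: "('a::complex_inner l2 \<Rightarrow> 'a l2) \<Rightarrow> (nat \<Rightarrow> 'a) \<Rightarrow> (nat \<Rightarrow> 'a)" where
  "on_l2set U f = Rep_l2 (U (Abs_l2 f))"

lemma on_l2set_Rep [simp]: "on_l2set U (Rep_l2 x) = Rep_l2 (U x)"
  by (simp add: on_l2set_def Rep_l2_inverse)

lemma bij_betw_on_l2set:
  assumes "unitary_op U"
  shows "bij_betw (on_l2set U) l2set l2set"
  by (rule bij_betwI[where g = "on_l2set (cadjoint U)"])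
    (use assms in \<open>auto simp: l2set_eq_range unitary_op_def\<close>)

lemma unitary_on_on_l2set:
  fixes U :: "'a::chilbert_space l2 \<Rightarrow> 'a l2"
  assumes U: "contraction U" "unitary_op U"
  shows "unitary_on l2set (on_l2set U)"
proof -
  have lin: "clinear U" using U by (simp add: contraction_def)
  have "cinner (U x) (U y) = cinner x y" for x y
    using U(2) by (simp add: adjoint_pairD[OF contraction_adjoint_pair[OF U(1)]] unitary_op_def)
  then show ?thesis
    unfolding unitary_on_def
    by (auto simp: bij_betw_on_l2set[OF U(2)]) (auto simp: l2set_eq_range l2_ops_Rep clinear_add[OF lin] clinear_scaleC[OF lin])
qed

text \<open>For a unitary the set-theoretic inverse is the adjoint, so the negative powers in the
  two conventions agree.\<close>

lemma upow_on_l2set: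
  assumes U: "unitary_op U"
  shows "upow l2set (on_l2set U) m (Rep_l2 x) = Rep_l2 (op_pow U m x)"
proof -
  have inv: "inv_into l2set (on_l2set U) (Rep_l2 x) = Rep_l2 (cadjoint U x)" for x
    by (rule inv_into_f_eq[OF bij_betw_imp_inj_on[OF bij_betw_on_l2set[OF U]]])
      (use U in \<open>simp_all add: Rep_l2 unitary_op_def\<close>)
  have "(on_l2set U ^^ n) (Rep_l2 x) = Rep_l2 ((U ^^ n) x)"
    "(inv_into l2set (on_l2set U) ^^ n) (Rep_l2 x) = Rep_l2 ((cadjoint U ^^ n) x)" for n
    by (induction n) (simp_all add: inv)
  then show ?thesis by (simp add: upow_def op_pow_def)
qed

text \<open>The condition on \<open>z\<close> says that \<open>z\<close> is the adjoint of
  \<open>J\<close> applied to \<open>y\<close>; for an isometry, \<open>J\<close> of that vector is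
  the projection onto its range.\<close>

lemma l2proj_range:
  assumes iso: "\<And>x y. cinner (J x) (J y) = cinner x y" and z: "\<And>x. cinner y (J x) = cinner z x"
  shows "l2proj (range (\<lambda>x. Rep_l2 (J x))) (Rep_l2 y) = Rep_l2 (J z)"
  unfolding l2proj_def
proof (rule the_equality)
  show "Rep_l2 (J z) \<in> range (\<lambda>x. Rep_l2 (J x)) \<and>
      (\<forall>s\<in>range (\<lambda>x. Rep_l2 (J x)). l2inner (l2diff (Rep_l2 y) (Rep_l2 (J z))) s = 0)"
    by (auto simp: l2_ops_Rep cinner_diff_left iso z)
  fix p assume "p \<in> range (\<lambda>x. Rep_l2 (J x)) \<and>
      (\<forall>s\<in>range (\<lambda>x. Rep_l2 (J x)). l2inner (l2diff (Rep_l2 y) p) s = 0)"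
  then obtain w where w: "p = Rep_l2 (J w)" and "\<And>x. cinner z x - cinner w x = 0"
    by (auto simp: l2_ops_Rep cinner_diff_left iso z)
  then have "w = z" by (intro cinner_eq_imp_eq_left) simp
  with w show "p = Rep_l2 (J z)" by simp
qed

theorem theorem3p6:
  fixes T :: "nat \<Rightarrow> 'a::chilbert_space \<Rightarrow> 'a"
    and q :: "nat \<Rightarrow> nat \<Rightarrow> complex"
    and k :: nat
  assumes contr: "\<forall>i\<in>{1..k}. contraction (T i)"
    and q_circle: "\<forall>i j. 1 \<le> i \<and> i < j \<and> j \<le> k \<longrightarrow> cmod (q i j) = 1"
    and q_comm: "\<forall>i j. 1 \<le> i \<and> i < j \<and> j \<le> k \<longrightarrow>
                   (\<forall>x. T i (T j x) = q i j *\<^sub>C T j (T i x))"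
    and q_comm_adj: "\<forall>i j. 1 \<le> i \<and> i < j \<and> j \<le> k \<longrightarrow>
                   (\<forall>x. T i (cadjoint (T j) x) = cnj (q i j) *\<^sub>C cadjoint (T j) (T i x))"
  shows "\<exists>(K :: (nat \<Rightarrow> 'a) set) (J :: 'a \<Rightarrow> (nat \<Rightarrow> 'a)) (U :: nat \<Rightarrow> (nat \<Rightarrow> 'a) \<Rightarrow> (nat \<Rightarrow> 'a)).
           closed_l2_subspace K \<and>
           (\<forall>x y. J (x + y) = l2add (J x) (J y)) \<and> (\<forall>c x. J (c *\<^sub>C x) = l2scale c (J x)) \<and>
            (\<forall>x. J x \<in> K) \<and> (\<forall>x y. l2inner (J x) (J y) = cinner x y) \<and>
           (\<forall>i\<in>{1..k}. unitary_on K (U i)) \<and>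
           (\<forall>i j. 1 \<le> i \<and> i < j \<and> j \<le> k \<longrightarrow>
              (\<forall>f\<in>K. U i (U j f) = l2scale (q i j) (U j (U i f)))) \<and>
           (\<forall>m :: nat \<Rightarrow> int. \<forall>x.
              J (ordered_prod (\<lambda>i. op_pow (T i) (m i)) k x)
                = l2proj (range J) (ordered_prod (\<lambda>i. upow K (U i) (m i)) k (J x)))"
proof -
  \<comment> \<open>Conjugate symmetry extends \<open>q\<close> to all ordered pairs; the value 1 on
    the diagonal keeps \<open>Q\<close> symmetric and unimodular there.\<close>
  define Q where "Q i j = (if i < j then q i j else if j < i then cnj (q j i) else 1)" for i j
  have Q_unit: "cmod (Q i j) = 1" if "i \<in> {1..k}" "j \<in> {1..k}" for i j
    using q_circle that by (auto simp: Q_def)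
  have Q_sym: "Q j i = cnj (Q i j)" for i j
    by (simp add: Q_def)
  have "doubly_commuting k Q T"
    unfolding doubly_commuting_def
  proof (intro conjI ballI impI allI)
    show "contraction (T i)" if "i \<in> {1..k}" for i using contr that by blast
    fix i j x assume i: "i \<in> {1..k}" and j: "j \<in> {1..k}" and ij: "i \<noteq> j"
    have unit: "cmod (q j i) = 1" if "j < i" using q_circle that i j by simp
    note pair = contraction_adjoint_pair[OF contr[rule_format, OF i]]
      contraction_adjoint_pair[OF contr[rule_format, OF j]]
    have comm: "T j (T i y) = q j i *\<^sub>C T i (T j y)"
      and adj: "T j (cadjoint (T i) y) = cnj (q j i) *\<^sub>C cadjoint (T i) (T j y)" if "j < i" for y
      using q_comm[rule_format, of j i y] q_comm_adj[rule_format, of j i y] that i j by simp_all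
    show "T i (T j x) = Q i j *\<^sub>C T j (T i x)"
    proof (cases "i < j")
      case True
      then show ?thesis using q_comm[rule_format, of i j x] i j by (simp add: Q_def)
    next
      case False
      then have "j < i" using ij by simp
      from twisted_commute_swap[OF unit[OF this] comm[OF this]] this show ?thesis by (simp add: Q_def)
    qed
    show "T i (cadjoint (T j) x) = cnj (Q i j) *\<^sub>C cadjoint (T j) (T i x)"
    proof (cases "i < j")
      case True
      then show ?thesis using q_comm_adj[rule_format, of i j x] i j by (simp add: Q_def)
    next
      case False
      then have "j < i" using ij by simp
      \<comment> \<open>Adjoints of the hypothesis for \<open>j < i\<close> give the relation with
        scalar \<open>q j i\<close>, which equals \<open>cnj (Q i j)\<close>.\<close>
      from cadjoint_twisted_commute[OF pair(2) adjoint_pair_sym[OF pair(1)] adj[OF this]] this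
      show ?thesis by (simp add: Q_def)
    qed
  qed
  from simultaneous_dilation[OF this Q_unit Q_sym order_refl]
  obtain V :: "nat \<Rightarrow> 'a l2 \<Rightarrow> 'a l2" and J where V: "doubly_commuting k Q V"
    and U: "\<And>i. i \<in> {1..k} \<Longrightarrow> unitary_op (V i)"
    and J: "clinear J" "\<And>x y. cinner (J x) (J y) = cinner x y" and dil: "weak_dilation k V J T"
    by auto
  let ?J = "\<lambda>x. Rep_l2 (J x)" and ?U = "\<lambda>i. on_l2set (V i)"
  have comm: "?U i (?U j f) = l2scale (q i j) (?U j (?U i f))"
    if "1 \<le> i \<and> i < j \<and> j \<le> k" "f \<in> l2set" for i j f
  proof -
    have "V i (V j x) = q i j *\<^sub>C V j (V i x)" for x
      using doubly_commutingD(2)[OF V, of i j x] that(1) by (simp add: Q_def)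
    then show ?thesis using that(2) by (auto simp: l2set_eq_range l2_ops_Rep)
  qed
  have dilation: "?J (ordered_prod (\<lambda>i. op_pow (T i) (m i)) k x)
      = l2proj (range ?J) (ordered_prod (\<lambda>i. upow l2set (?U i) (m i)) k (?J x))" for m x
  proof -
    have "Rep_l2 (ordered_prod (\<lambda>i. op_pow (V i) (m i)) k (J x))
        = ordered_prod (\<lambda>i. upow l2set (?U i) (m i)) k (?J x)"
      by (rule ordered_prod_commute_map) (simp add: upow_on_l2set U)
    moreover have "l2proj (range ?J) (Rep_l2 (ordered_prod (\<lambda>i. op_pow (V i) (m i)) k (J x)))
        = ?J (ordered_prod (\<lambda>i. op_pow (T i) (m i)) k x)"
      \<comment> \<open>\<open>weak_dilation\<close> states exactly that the product of the
        \<open>T i\<close> is the vector \<open>z\<close> required by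
        \<open>l2proj_range\<close>.\<close>
      by (rule l2proj_range[OF J(2)]) (use dil in \<open>simp add: weak_dilation_def\<close>)
    ultimately show ?thesis by simp
  qed
  have "unitary_on l2set (?U i)" if "i \<in> {1..k}" for i
    by (rule unitary_on_on_l2set[OF doubly_commutingD(1)[OF V that] U[OF that]])
  then show ?thesis
    using comm dilation J
    by (intro exI[of _ l2set] exI[of _ ?J] exI[of _ ?U] conjI closed_l2_subspace_l2set)
      (auto simp: l2_ops_Rep Rep_l2 clinear_add[OF J(1)] clinear_scaleC[OF J(1)])
qed

end
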